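(* Let $T=[0,\infty)$. For every $u_0\in\mathcal V_{[0,1]}$ there exist $u:T\to\mathcal V_{[0,1]}$ and $\beta:T\to\mathcal V$ with $u\in H^1_{loc}(T;\mathcal V)\cap C^0(T;\mathcal V)$ and $u(0)=u_0$ such that $(u,\beta)$ is a solution to mass-conserving double-obstacle AC flow on $T$.
   Context: $G=(V,E)$ is a finite, simple, connected, undirected graph with weights $\omega_{ij}=\omega_{ji}>0$ for $ij\in E$, $\omega_{ij}=0$ otherwise; $d_i=\sum_j\omega_{ij}$, $r\in[0,1]$ fixed. $\mathcal V$ = functions $V\to\mathbb R$ with $\langle u,v\rangle_{\mathcal V}=\sum_i u_iv_id_i^r$; $\mathcal V_X$ = functions $V\to X$. $(\Delta u)_i=d_i^{-r}\sum_j\omega_{ij}(u_i-u_j)$. $\mathbf 1$ all-ones; $\mathcal M(u)=\langle u,\mathbf 1\rangle_{\mathcal V}$; $\bar v=\mathcal M(v)/\mathcal M(\mathbf 1)$. $\varepsilon>0$. For $u\in\mathcal V_{[0,1]}$, $\mathcal B(u)$ = set of $\beta\in\mathcal V$ with $\beta_i\ge0$ if $u_i=0$, $\beta_i=0$ if $0<u_i<1$, $\beta_i\le0$ if $u_i=1$; $\mathcal B(u)=\emptyset$ otherwise. $H^1_{loc}(T;\mathcal V)$: functions $T\to\mathcal V$ whose components lie in $H^1((a,b))$ for all $a,b\in T$, with weak derivative $du/dt$. A pair $(u,\beta)$ is a solution to mass-conserving double-obstacle AC flow on $T$ if $u\in H^1_{loc}(T;\mathcal V)\cap C^0(T;\mathcal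 V)$, $u(t)\in\mathcal V_{[0,1]}$ for all $t$, and for a.e. $t\in T$: $\varepsilon \frac{du}{dt} + \varepsilon\Delta u(t)-u(t)+\overline{u(t)}\mathbf{1} = \beta(t) - \overline{\beta(t)}\mathbf{1}$ and $\beta(t)\in\mathcal B(u(t))$. *)

theory Defs
  imports "HOL-Analysis.Analysis"
begin

text \<open>Vertices: a finite type 'v (V = UNIV). Weights w i j; the edge set is {ij. w i j > 0}.\<close>

definition weighted_graph :: "('v::finite \<Rightarrow> 'v \<Rightarrow> real) \<Rightarrow> bool" where
  "weighted_graph w \<longleftrightarrow>
     (\<forall>i j. w i j = w j i) \<and> (\<forall>i j. w i j \<ge> 0) \<and> (\<forall>i. w i i = 0) \<and>
     (\<forall>i j. (\<lambda>a b. w a b > 0)\<^sup>*\<^sup>* i j)"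

definition degree :: "('v::finite \<Rightarrow> 'v \<Rightarrow> real) \<Rightarrow> 'v \<Rightarrow> real" where
  "degree w i = (\<Sum>j\<in>UNIV. w i j)"

definition dpow :: "('v::finite \<Rightarrow> 'v \<Rightarrow> real) \<Rightarrow> real \<Rightarrow> 'v \<Rightarrow> real" where
  "dpow w r i = (if r = 0 then 1 else degree w i powr r)"

definition inner_V :: "('v::finite \<Rightarrow> 'v \<Rightarrow> real) \<Rightarrow> real \<Rightarrow> ('v \<Rightarrow> real) \<Rightarrow> ('v \<Rightarrow> real) \<Rightarrow> real" where
  "inner_V w r u v = (\<Sum>i\<in>UNIV. u i * v i * dpow w r i)"

definition graph_laplacian :: "('v::finite \<Rightarrow> 'v \<Rightarrow> real) \<Rightarrow> real \<Rightarrow> ('v \<Rightarrow> real) \<Rightarrow> 'v \<Rightarrow> real" where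
  "graph_laplacian w r u i = (1 / dpow w r i) * (\<Sum>j\<in>UNIV. w i j * (u i - u j))"

definition mass :: "('v::finite \<Rightarrow> 'v \<Rightarrow> real) \<Rightarrow> real \<Rightarrow> ('v \<Rightarrow> real) \<Rightarrow> real" where
  "mass w r u = inner_V w r u (\<lambda>_. 1)"

definition mean_V :: "('v::finite \<Rightarrow> 'v \<Rightarrow> real) \<Rightarrow> real \<Rightarrow> ('v \<Rightarrow> real) \<Rightarrow> real" where
  "mean_V w r v = mass w r v / mass w r (\<lambda>_. 1)"

definition in_box :: "('v \<Rightarrow> real) \<Rightarrow> bool" where
  "in_box u \<longleftrightarrow> (\<forall>i. 0 \<le> u i \<and> u i \<le> 1)"

definition Bset :: "('v \<Rightarrow> real) \<Rightarrow> ('v \<Rightarrow> real) set" where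
  "Bset u = (if in_box u then
     {\<beta>. \<forall>i. (u i = 0 \<longrightarrow> \<beta> i \<ge> 0) \<and> (0 < u i \<and> u i < 1 \<longrightarrow> \<beta> i = 0) \<and> (u i = 1 \<longrightarrow> \<beta> i \<le> 0)}
   else {})"

definition smooth_fun :: "(real \<Rightarrow> real) \<Rightarrow> bool" where
  "smooth_fun \<phi> \<longleftrightarrow> (\<forall>k x. ((deriv ^^ k) \<phi>) differentiable (at x))"

definition test_fun :: "real \<Rightarrow> real \<Rightarrow> (real \<Rightarrow> real) \<Rightarrow> bool" where
  "test_fun a b \<phi> \<longleftrightarrow> smooth_fun \<phi> \<and>
     (\<exists>c d. a < c \<and> c \<le> d \<and> d < b \<and> (\<forall>x. x \<notin> {c..d} \<longrightarrow> \<phi> x = 0))"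

definition L2_on :: "real \<Rightarrow> real \<Rightarrow> (real \<Rightarrow> real) \<Rightarrow> bool" where
  "L2_on a b f \<longleftrightarrow> (\<lambda>t. indicator {a<..<b} t * f t) \<in> borel_measurable lborel \<and>
     set_integrable lborel {a<..<b} (\<lambda>t. (f t)\<^sup>2)"

definition weak_deriv_on :: "real \<Rightarrow> real \<Rightarrow> (real \<Rightarrow> real) \<Rightarrow> (real \<Rightarrow> real) \<Rightarrow> bool" where
  "weak_deriv_on a b f g \<longleftrightarrow> L2_on a b f \<and> L2_on a b g \<and>
     (\<forall>\<phi>. test_fun a b \<phi> \<longrightarrow>
        (LINT t:{a<..<b}|lborel. f t * deriv \<phi> t) = - (LINT t:{a<..<b}|lborel. g t * \<phi> t))"

definition H1_loc_deriv :: "real set \<Rightarrow> (real \<Rightarrow> 'v \<Rightarrow> real) \<Rightarrow> (real \<Rightarrow> 'v \<Rightarrow> real) \<Rightarrow> bool" where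
  "H1_loc_deriv T u u' \<longleftrightarrow>
     (\<forall>i a b. a \<in> T \<longrightarrow> b \<in> T \<longrightarrow> a < b \<longrightarrow> weak_deriv_on a b (\<lambda>t. u t i) (\<lambda>t. u' t i))"

definition H1_loc :: "real set \<Rightarrow> (real \<Rightarrow> 'v \<Rightarrow> real) \<Rightarrow> bool" where
  "H1_loc T u \<longleftrightarrow> (\<exists>u'. H1_loc_deriv T u u')"

definition C0_on :: "real set \<Rightarrow> (real \<Rightarrow> 'v \<Rightarrow> real) \<Rightarrow> bool" where
  "C0_on T u \<longleftrightarrow> (\<forall>i. continuous_on T (\<lambda>t. u t i))"

definition mc_AC_solution ::
  "('v::finite \<Rightarrow> 'v \<Rightarrow> real) \<Rightarrow> real \<Rightarrow> real \<Rightarrow> real set \<Rightarrow>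
   (real \<Rightarrow> 'v \<Rightarrow> real) \<Rightarrow> (real \<Rightarrow> 'v \<Rightarrow> real) \<Rightarrow> bool" where
  "mc_AC_solution w r \<epsilon> T u \<beta> \<longleftrightarrow>
     C0_on T u \<and> (\<forall>t\<in>T. in_box (u t)) \<and>
     (\<exists>u'. H1_loc_deriv T u u' \<and>
        (AE t in lborel. t \<in> T \<longrightarrow>
           (\<forall>i. \<epsilon> * u' t i + \<epsilon> * graph_laplacian w r (u t) i - u t i + mean_V w r (u t)
                = \<beta> t i - mean_V w r (\<beta> t)) \<and>
           \<beta> t \<in> Bset (u t)))"

end

theory Submission
  imports Defs "HOL-Complex_Analysis.Great_Picard"
begin

text \<open>
  On the convex set \<open>K\<close> of admissible states of fixed mass the flow is the projected
  equation \<open>u' = F(u) - n\<close> with \<open>n\<close> in the normal cone of \<open>K\<close> at \<open>u\<close>, with respect to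
  the weighted inner product; the mean of \<open>\<beta>\<close> is the multiplier of the mass constraint. A
  solution is a subsequential limit of the Euler scheme that projects back onto \<open>K\<close> after every
  step. Two estimates survive the limit: the variational inequality, which forces
  \<open>F(u) - d\<close> into the normal cone for every limit point \<open>d\<close> of the forward difference quotients,
  and the speed bound \<open>norm d \<le> dist (F u) (normal cone)\<close>. Together they identify
  \<open>F(u) - d\<close> as the point of the normal cone closest to \<open>F(u)\<close>. Hence the
  right derivative exists at every time, with no appeal to differentiation almost everywhere, and
  for a Lipschitz path it is the weak derivative, by translating the difference quotient onto the
  test function.
\<close>

section \<open>Projected flows\<close>

text \<open>The diameter bound serves twice: it keeps the Euler paths bounded, so that a subsequence
  converges, and it enters the error constant \<open>L * D + M\<close> of the variational
  inequality.\<close>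

locale projected_field =
  fixes K :: "'a::euclidean_space set" and F :: "'a \<Rightarrow> 'a" and L M D :: real
  assumes closed_K: "closed K" and convex_K: "convex K"
    and norm_F_le: "\<And>x. x \<in> K \<Longrightarrow> norm (F x) \<le> M"
    and F_lipschitz: "\<And>x y. x \<in> K \<Longrightarrow> y \<in> K \<Longrightarrow> norm (F x - F y) \<le> L * norm (x - y)"
    and diameter_le: "\<And>x y. x \<in> K \<Longrightarrow> y \<in> K \<Longrightarrow> norm (x - y) \<le> D"
    and L_nonneg: "0 \<le> L" and M_nonneg: "0 \<le> M" and D_nonneg: "0 \<le> D"
begin

section \<open>Estimates for the projected Euler scheme\<close>

definition euler_step :: "real \<Rightarrow> 'a \<Rightarrow> 'a" where
  "euler_step h x = closest_point K (x + h *\<^sub>R F x)"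

lemma euler_step_in: "x \<in> K \<Longrightarrow> euler_step h x \<in> K"
  unfolding euler_step_def using closed_K by (auto intro: closest_point_in_set)

lemma euler_iterate_in: "x \<in> K \<Longrightarrow> (euler_step h ^^ k) x \<in> K"
  by (induction k) (auto intro: euler_step_in)

text \<open>Projection onto a closed convex set is nonexpansive and fixes \<open>v\<close>.\<close>

lemma norm_euler_step_diff_le:
  assumes "x \<in> K" "v \<in> K"
  shows "norm (euler_step h x - v) \<le> norm (x + h *\<^sub>R F x - v)"
  using closest_point_lipschitz[OF convex_K closed_K, of "x + h *\<^sub>R F x" v] assms
    closest_point_self[of v K]
  by (auto simp: euler_step_def dist_norm)

lemma euler_iterate_near:
  assumes "y \<in> K" "0 \<le> h"
  shows "norm ((euler_step h ^^ k) y - y) \<le> real k * h * M"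
proof (induction k)
  case (Suc k)
  let ?x = "(euler_step h ^^ k) y"
  have x: "?x \<in> K" by (rule euler_iterate_in[OF assms(1)])
  \<comment> \<open>The one-step bound with \<open>v\<close> taken as the current iterate: each step
    has length at most \<open>h * M\<close>.\<close>
  have "norm (euler_step h ?x - ?x) \<le> h * norm (F ?x)"
    using norm_euler_step_diff_le[OF x x, of h] assms(2) by simp
  also have "\<dots> \<le> h * M" using norm_F_le[OF x] assms(2) by (rule mult_left_mono)
  finally have "norm (euler_step h ?x - y) \<le> h * M + k * h * M"
    using Suc norm_triangle_ineq[of "euler_step h ?x - ?x" "?x - y"] by simp
  then show ?case by (simp add: algebra_simps)
qed simp

text \<open>Freezes the field at \<open>p\<close>: changing \<open>F x\<close> to \<open>F p\<close>
  costs \<open>L * norm (x - p)\<close> times the diameter, and changing \<open>x\<close> to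
  \<open>p\<close> in the other factor costs \<open>M * norm (x - p)\<close>.\<close>

lemma inner_F_diff_le:
  assumes "x \<in> K" "p \<in> K" "v \<in> K"
  shows "F x \<bullet> (x - v) \<le> F p \<bullet> (p - v) + (L * D + M) * norm (x - p)"
proof -
  have "F x \<bullet> (x - v) = F p \<bullet> (p - v) + (F x - F p) \<bullet> (x - v) + F p \<bullet> (x - p)"
    by (simp add: algebra_simps inner_diff_left inner_diff_right)
  moreover have "(F x - F p) \<bullet> (x - v) \<le> (L * norm (x - p)) * D"
  proof -
    have "(F x - F p) \<bullet> (x - v) \<le> norm (F x - F p) * norm (x - v)"
      by (rule norm_cauchy_schwarz)
    also have "\<dots> \<le> (L * norm (x - p)) * D"
      using F_lipschitz diameter_le assms L_nonneg by (intro mult_mono) auto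
    finally show ?thesis .
  qed
  moreover have "F p \<bullet> (x - p) \<le> M * norm (x - p)"
    using norm_cauchy_schwarz[of "F p" "x - p"]
      mult_right_mono[OF norm_F_le[OF assms(2)], of "norm (x - p)"] by simp
  ultimately show ?thesis by (simp add: algebra_simps)
qed

text \<open>The discrete variational inequality: the squared one-step bound is expanded, the inner
  product is frozen at \<open>p\<close>, and the steps are summed. The cap \<open>m\<close> on the
  number of steps keeps the error bracket independent of \<open>k\<close>, so the induction adds the
  same bracket each time.\<close>

lemma euler_iterate_variational:
  assumes "y \<in> K" "p \<in> K" "v \<in> K" "0 \<le> h" "k \<le> m"
  shows "(norm ((euler_step h ^^ k) y - v))\<^sup>2 \<le> (norm (y - v))\<^sup>2
    + k * h * (2 * (F p \<bullet> (p - v)) + 2 * (L * D + M) * (norm (y - p) + real m * h * M) + h * M\<^sup>2)"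
  using \<open>k \<le> m\<close>
proof (induction k)
  case (Suc k)
  let ?x = "(euler_step h ^^ k) y"
  have x: "?x \<in> K" by (rule euler_iterate_in[OF assms(1)])
  have LDM: "0 \<le> L * D + M" using L_nonneg D_nonneg M_nonneg by simp
  have "(norm (euler_step h ?x - v))\<^sup>2 \<le> (norm (?x + h *\<^sub>R F ?x - v))\<^sup>2"
    by (intro power_mono norm_euler_step_diff_le x assms) simp
  also have "\<dots> = (norm (?x - v))\<^sup>2 + h * (2 * (F ?x \<bullet> (?x - v)) + h * (norm (F ?x))\<^sup>2)"
    by (simp only: power2_norm_eq_inner)
      (simp add: algebra_simps inner_diff_left inner_diff_right inner_commute)
  also have "\<dots> \<le> (norm (?x - v))\<^sup>2 + h * (2 * (F p \<bullet> (p - v)) +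
      2 * (L * D + M) * (norm (y - p) + real m * h * M) + h * M\<^sup>2)"
  proof -
    have "norm (?x - p) \<le> norm (y - p) + k * h * M"
      using euler_iterate_near[OF assms(1,4), of k] norm_triangle_ineq[of "?x - y" "y - p"]
      by simp
    also have "\<dots> \<le> norm (y - p) + real m * h * M"
      using Suc.prems M_nonneg assms(4) by (intro add_left_mono mult_right_mono) auto
    finally have "(L * D + M) * norm (?x - p) \<le> (L * D + M) * (norm (y - p) + real m * h * M)"
      using LDM by (rule mult_left_mono)
    then have "F ?x \<bullet> (?x - v) \<le> F p \<bullet> (p - v) + (L * D + M) * (norm (y - p) + real m * h * M)"
      using inner_F_diff_le[OF x assms(2,3)] by linarith
    moreover have "h * (norm (F ?x))\<^sup>2 \<le> h * M\<^sup>2"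
      using norm_F_le[OF x] assms(4) by (intro mult_left_mono power_mono) auto
    ultimately have "2 * (F ?x \<bullet> (?x - v)) + h * (norm (F ?x))\<^sup>2 \<le> 2 * (F p \<bullet> (p - v)) +
        2 * (L * D + M) * (norm (y - p) + real m * h * M) + h * M\<^sup>2"
      by linarith
    then show ?thesis using assms(4) by (intro add_left_mono mult_left_mono)
  qed
  finally show ?case using Suc by (simp add: algebra_simps)
qed simp

text \<open>The hypothesis on \<open>P\<close> says that \<open>P\<close> bounds the component of \<open>F p\<close> tangential to \<open>K\<close>.\<close>

lemma euler_iterate_speed:
  assumes "y \<in> K" "p \<in> K" "0 \<le> h" "0 \<le> P"
    and P: "\<And>x. x \<in> K \<Longrightarrow> F p \<bullet> (x - p) \<le> P * norm (x - p)"
  shows "norm ((euler_step h ^^ k) y - p) \<le> exp (L * (k * h)) * (norm (y - p) + k * h * P)"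
proof (induction k)
  case (Suc k)
  let ?x = "(euler_step h ^^ k) y" and ?p' = "euler_step h p"
  have x: "?x \<in> K" by (rule euler_iterate_in[OF assms(1)])
  have p': "?p' \<in> K" by (rule euler_step_in[OF assms(2)])
  \<comment> \<open>Testing the obtuse-angle property of the projection with \<open>p\<close> itself
    shows that a step from \<open>p\<close> has length at most \<open>h * P\<close>.\<close>
  have "(norm (?p' - p))\<^sup>2 \<le> h * (F p \<bullet> (?p' - p))"
    using closest_point_dot[OF convex_K closed_K assms(2), of "p + h *\<^sub>R F p"]
    unfolding euler_step_def[symmetric] power2_norm_eq_inner
    by (simp add: algebra_simps inner_diff_left inner_diff_right inner_commute)
  also have "\<dots> \<le> h * (P * norm (?p' - p))"
    using P[OF p'] assms(3) by (rule mult_left_mono)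
  finally have "norm (?p' - p) * norm (?p' - p) \<le> (h * P) * norm (?p' - p)"
    by (simp add: power2_eq_square)
  then have 1: "norm (?p' - p) \<le> h * P"
    using assms(3,4) by (cases "norm (?p' - p) = 0") (auto simp: mult_le_cancel_right)
  \<comment> \<open>The steps from the iterate and from \<open>p\<close> are compared: the
    projection is nonexpansive, which leaves the explicit growth factor \<open>1 + L * h\<close>, at
    most \<open>exp (L * h)\<close>.\<close>
  have "norm (euler_step h ?x - ?p') \<le> norm ((?x + h *\<^sub>R F ?x) - (p + h *\<^sub>R F p))"
    using closest_point_lipschitz[OF convex_K closed_K, of "?x + h *\<^sub>R F ?x" "p + h *\<^sub>R F p"] x
    by (auto simp: euler_step_def dist_norm)
  also have "(?x + h *\<^sub>R F ?x) - (p + h *\<^sub>R F p) = (?x - p) + h *\<^sub>R (F ?x - F p)"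
    by (simp add: algebra_simps)
  also have "norm \<dots> \<le> norm (?x - p) + h * norm (F ?x - F p)"
    using norm_triangle_ineq[of "?x - p" "h *\<^sub>R (F ?x - F p)"] assms(3) by simp
  also have "\<dots> \<le> norm (?x - p) + h * (L * norm (?x - p))"
    using F_lipschitz[OF x assms(2)] assms(3) by (intro add_left_mono mult_left_mono)
  also have "\<dots> = (1 + L * h) * norm (?x - p)" by (simp add: algebra_simps)
  also have "\<dots> \<le> exp (L * h) * norm (?x - p)"
    by (intro mult_right_mono exp_ge_add_one_self) simp
  also have "\<dots> \<le> exp (L * h) * (exp (L * (k * h)) * (norm (y - p) + k * h * P))"
    by (intro mult_left_mono Suc) simp
  also have "\<dots> = exp (L * (real (Suc k) * h)) * (norm (y - p) + k * h * P)"
    by (simp add: exp_add[symmetric] algebra_simps)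
  finally have 2: "norm (euler_step h ?x - ?p') \<le> exp (L * (real (Suc k) * h)) * (norm (y - p) + k * h * P)" .
  \<comment> \<open>The exponential is at least 1, so the step from \<open>p\<close> can be absorbed
    into the bracket.\<close>
  have "1 * (h * P) \<le> exp (L * (real (Suc k) * h)) * (h * P)"
    using L_nonneg assms(3,4) by (intro mult_right_mono) auto
  then have "norm (euler_step h ?x - p) \<le> exp (L * (real (Suc k) * h)) * (norm (y - p) + k * h * P)
      + exp (L * (real (Suc k) * h)) * (h * P)"
    using 1 2 norm_triangle_ineq[of "euler_step h ?x - ?p'" "?p' - p"] by simp
  then show ?case by (simp add: algebra_simps)
qed simp

section \<open>Compactness of the Euler paths\<close>

definition euler_path :: "'a \<Rightarrow> nat \<Rightarrow> real \<Rightarrow> 'a" where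
  "euler_path x0 n t = (euler_step (1 / Suc n) ^^ nat \<lfloor>t * real (Suc n)\<rfloor>) x0"

lemma euler_path_in: "x0 \<in> K \<Longrightarrow> euler_path x0 n t \<in> K"
  unfolding euler_path_def by (rule euler_iterate_in)

text \<open>The scheme is autonomous: after time \<open>s\<close> it runs as if restarted from its
  value there, for \<open>k\<close> further steps.\<close>

lemma euler_path_shift:
  assumes "s \<le> t"
  obtains k where "euler_path x0 n t = (euler_step (1 / Suc n) ^^ k) (euler_path x0 n s)"
    "nat \<lfloor>t * real (Suc n)\<rfloor> = nat \<lfloor>s * real (Suc n)\<rfloor> + k"
proof -
  have "nat \<lfloor>s * real (Suc n)\<rfloor> \<le> nat \<lfloor>t * real (Suc n)\<rfloor>"
    using assms by (intro nat_mono floor_mono mult_right_mono) auto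
  then obtain k where k: "nat \<lfloor>t * real (Suc n)\<rfloor> = nat \<lfloor>s * real (Suc n)\<rfloor> + k"
    using le_Suc_ex by blast
  then have "nat \<lfloor>t * real (Suc n)\<rfloor> = k + nat \<lfloor>s * real (Suc n)\<rfloor>" by simp
  then show ?thesis
    by (intro that[OF _ k]) (simp only: euler_path_def funpow_add o_apply)
qed

text \<open>The paths are step functions; the extra \<open>1 / Suc n\<close> pays for rounding the
  times to the grid.\<close>

lemma norm_euler_path_diff_le:
  assumes "x0 \<in> K"
  shows "norm (euler_path x0 n t - euler_path x0 n s) \<le> (\<bar>t - s\<bar> + 1 / Suc n) * M"
proof -
  have *: "norm (euler_path x0 n t - euler_path x0 n s) \<le> (t - s + 1 / Suc n) * M" if st: "s \<le> t" for s t
  proof -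
    obtain k where k: "euler_path x0 n t = (euler_step (1 / Suc n) ^^ k) (euler_path x0 n s)"
      and kn: "nat \<lfloor>t * real (Suc n)\<rfloor> = nat \<lfloor>s * real (Suc n)\<rfloor> + k"
      using euler_path_shift[OF st] by blast
    have "real k \<le> t * real (Suc n) - s * real (Suc n) + 1"
    \<comment> \<open>At negative times \<open>nat\<close> truncates the floor to 0 and the path
      rests at \<open>x0\<close>, so no step is made between \<open>s\<close> and
      \<open>t\<close>.\<close>
    proof (cases "0 \<le> \<lfloor>t * real (Suc n)\<rfloor>")
      case True
      then have "real (nat \<lfloor>t * real (Suc n)\<rfloor>) \<le> t * real (Suc n)" by linarith
      moreover have "s * real (Suc n) < real (nat \<lfloor>s * real (Suc n)\<rfloor>) + 1" by linarith
      ultimately show ?thesis using kn by linarith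
    next
      case False
      then have "k = 0" using kn by simp
      moreover have "s * real (Suc n) \<le> t * real (Suc n)" using that by (intro mult_right_mono) auto
      ultimately show ?thesis by simp
    qed
    then have "real k \<le> (t - s + 1 / Suc n) * real (Suc n)"
      by (simp add: distrib_right left_diff_distrib del: of_nat_Suc)
    then have "real k * (1 / Suc n) \<le> t - s + 1 / Suc n"
      by (simp only: mult_1_right times_divide_eq_right pos_divide_le_eq of_nat_0_less_iff zero_less_Suc)
    then have "real k * (1 / Suc n) * M \<le> (t - s + 1 / Suc n) * M"
      using M_nonneg by (rule mult_right_mono)
    moreover have "norm (euler_path x0 n t - euler_path x0 n s) \<le> real k * (1 / Suc n) * M"
      unfolding k using euler_iterate_near[OF euler_path_in[OF assms], of "1 / Suc n"] by simp
    ultimately show ?thesis by linarith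
  qed
  show ?thesis
    using *[of s t] *[of t s] by (cases "s \<le> t") (auto simp: norm_minus_commute abs_if)
qed

text \<open>An Arzela-Ascoli argument for discontinuous paths: a diagonal subsequence converges at
  all rational times, and equicontinuity up to the mesh size carries the Cauchy property to every
  real time.\<close>

lemma euler_paths_converge:
  assumes "x0 \<in> K"
  shows "\<exists>\<sigma> u. strict_mono \<sigma> \<and> (\<forall>t. (\<lambda>n. euler_path x0 (\<sigma> n) t) \<longlonglongrightarrow> u t)"
proof -
  have "norm (euler_path x0 n q) \<le> norm x0 + D" for n q
    using diameter_le[OF euler_path_in[OF assms] assms, of n q]
      norm_triangle_ineq2[of "euler_path x0 n q" x0] by linarith
  then obtain \<sigma> where \<sigma>: "strict_mono \<sigma>"
    and conv: "\<And>q. q \<in> \<rat> \<Longrightarrow> \<exists>l. (\<lambda>n. euler_path x0 (\<sigma> n) q) \<longlonglongrightarrow> l"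
    using function_convergent_subsequence[OF countable_rat, of "euler_path x0" "norm x0 + D"]
    by blast
  have "Cauchy (\<lambda>n. euler_path x0 (\<sigma> n) t)" for t
  proof (rule metric_CauchyI)
    fix e :: real assume e: "e > 0"
    \<comment> \<open>The distance to a rational time and the mesh will both be below
      \<open>\<delta>\<close>, which costs at most \<open>e / 4\<close> for each of the two paths
      compared; \<open>M + 1\<close> guards against \<open>M = 0\<close>.\<close>
    define \<delta> where "\<delta> = e / (8 * (M + 1))"
    have \<delta>: "\<delta> > 0" "\<delta> * M \<le> e / 8"
      using e M_nonneg by (auto simp: \<delta>_def field_simps)
    obtain q where q: "q \<in> \<rat>" "\<bar>t - q\<bar> < \<delta>"
      using Rats_dense_in_real[of "t - \<delta>" "t + \<delta>"] \<delta> by (auto simp: abs_if)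
    have "Cauchy (\<lambda>n. euler_path x0 (\<sigma> n) q)"
      using conv[OF q(1)] by (auto intro: LIMSEQ_imp_Cauchy)
    then obtain N1 where N1: "\<And>m n. m \<ge> N1 \<Longrightarrow> n \<ge> N1 \<Longrightarrow>
        dist (euler_path x0 (\<sigma> m) q) (euler_path x0 (\<sigma> n) q) < e / 4"
      using e by (metis Cauchy_def zero_less_divide_iff zero_less_numeral)
    obtain N2 where N2: "1 / Suc N2 < \<delta>"
      using nat_approx_posE[OF \<delta>(1)] by auto
    have near: "dist (euler_path x0 (\<sigma> n) t) (euler_path x0 (\<sigma> n) q) \<le> e / 4" if "n \<ge> N2" for n
    proof -
      have "N2 \<le> \<sigma> n" using that seq_suble[OF \<sigma>, of n] by linarith
      then have "1 / Suc (\<sigma> n) \<le> 1 / Suc N2" by (intro divide_left_mono) auto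
      then have "(\<bar>t - q\<bar> + 1 / Suc (\<sigma> n)) * M \<le> (\<delta> + \<delta>) * M"
        using N2 q M_nonneg by (intro mult_right_mono) auto
      then show ?thesis
        using norm_euler_path_diff_le[OF assms, of "\<sigma> n" t q] \<delta>(2) by (simp add: dist_norm algebra_simps)
    qed
    have "dist (euler_path x0 (\<sigma> m) t) (euler_path x0 (\<sigma> n) t) < e"
      if "m \<ge> max N1 N2" "n \<ge> max N1 N2" for m n
    proof -
      have "dist (euler_path x0 (\<sigma> m) t) (euler_path x0 (\<sigma> n) t)
        \<le> dist (euler_path x0 (\<sigma> m) t) (euler_path x0 (\<sigma> m) q)
        + dist (euler_path x0 (\<sigma> m) q) (euler_path x0 (\<sigma> n) q)
        + dist (euler_path x0 (\<sigma> n) t) (euler_path x0 (\<sigma> n) q)"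
        by metric
      then show ?thesis using near[of m] near[of n] N1[of m n] that e by simp
    qed
    then show "\<exists>N. \<forall>m\<ge>N. \<forall>n\<ge>N. dist (euler_path x0 (\<sigma> m) t) (euler_path x0 (\<sigma> n) t) < e"
      by blast
  qed
  then have "\<forall>t. \<exists>l. (\<lambda>n. euler_path x0 (\<sigma> n) t) \<longlonglongrightarrow> l"
    by (simp add: Cauchy_convergent_iff convergent_def)
  then have "\<exists>u. \<forall>t. (\<lambda>n. euler_path x0 (\<sigma> n) t) \<longlonglongrightarrow> u t" by (rule choice)
  with \<sigma> show ?thesis by blast
qed

end

text \<open>Applied at two times, this shows that the number of steps between them, multiplied by
  the step size, tends to the elapsed time.\<close>

lemma nat_floor_mult_Suc_div_tendsto:
  assumes "0 \<le> t"
  shows "(\<lambda>n. real (nat \<lfloor>t * real (Suc n)\<rfloor>) * (1 / Suc n)) \<longlonglongrightarrow> t"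
proof (rule real_tendsto_sandwich)
  show "\<forall>\<^sub>F n in sequentially. t - 1 / real (Suc n) \<le> real (nat \<lfloor>t * real (Suc n)\<rfloor>) * (1 / Suc n)"
  proof (intro always_eventually allI)
    fix n
    have "t * real (Suc n) - 1 \<le> real (nat \<lfloor>t * real (Suc n)\<rfloor>)" by linarith
    then have "(t * real (Suc n) - 1) / real (Suc n) \<le> real (nat \<lfloor>t * real (Suc n)\<rfloor>) / real (Suc n)"
      by (rule divide_right_mono) simp
    then show "t - 1 / real (Suc n) \<le> real (nat \<lfloor>t * real (Suc n)\<rfloor>) * (1 / Suc n)"
      by (simp add: diff_divide_distrib del: of_nat_Suc)
  qed
  show "\<forall>\<^sub>F n in sequentially. real (nat \<lfloor>t * real (Suc n)\<rfloor>) * (1 / Suc n) \<le> t"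
  proof (intro always_eventually allI)
    fix n
    have "0 \<le> t * real (Suc n)" using assms by simp
    then have "real (nat \<lfloor>t * real (Suc n)\<rfloor>) \<le> t * real (Suc n)" by linarith
    then show "real (nat \<lfloor>t * real (Suc n)\<rfloor>) * (1 / Suc n) \<le> t"
      by (simp add: divide_le_eq del: of_nat_Suc)
  qed
  have "(\<lambda>n. t - 1 / real (Suc n)) \<longlonglongrightarrow> t - 0"
    by (intro tendsto_diff tendsto_const LIMSEQ_Suc[OF lim_1_over_n])
  then show "(\<lambda>n. t - 1 / real (Suc n)) \<longlonglongrightarrow> t" by simp
qed simp

text \<open>Otherwise a subsequence keeps a positive distance from \<open>a\<close>, yet by
  compactness it has a convergent subsequence, whose limit must be \<open>a\<close>. This turns the
  identification of all limit points of the difference quotients into convergence.\<close>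

lemma bounded_tendsto_of_unique_limit_point:
  fixes x :: "nat \<Rightarrow> 'a::heine_borel"
  assumes "bounded (range x)"
    and "\<And>r l. strict_mono r \<Longrightarrow> (x \<circ> r) \<longlonglongrightarrow> l \<Longrightarrow> l = a"
  shows "x \<longlonglongrightarrow> a"
proof (rule ccontr)
  assume "\<not> x \<longlonglongrightarrow> a"
  then obtain e where e: "e > 0" "\<exists>\<^sub>F n in sequentially. \<not> dist (x n) a < e"
    unfolding tendsto_iff frequently_def by auto
  then have "\<exists>\<^sub>\<infinity>n. \<not> dist (x n) a < e" by (simp add: cofinite_eq_sequentially)
  then have inf: "infinite {n. \<not> dist (x n) a < e}" by (simp add: frequently_cofinite)
  define r where "r = enumerate {n. \<not> dist (x n) a < e}"
  have r: "strict_mono r" "\<And>n. \<not> dist (x (r n)) a < e"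
    using strict_mono_enumerate[OF inf] enumerate_in_set[OF inf] by (auto simp: r_def)
  have "bounded (range (x \<circ> r))"
    using assms(1) by (rule bounded_subset) auto
  then obtain l s where s: "strict_mono s" "((x \<circ> r) \<circ> s) \<longlonglongrightarrow> l"
    using bounded_imp_convergent_subsequence by blast
  then have "l = a"
    using assms(2)[of "r \<circ> s" l] strict_mono_o[OF r(1) s(1)] by (simp add: o_assoc)
  with s(2) have "\<forall>\<^sub>F n in sequentially. dist (((x \<circ> r) \<circ> s) n) a < e"
    using e(1) by (simp add: tendsto_iff)
  then show False using r(2) by (auto simp: eventually_sequentially)
qed

section \<open>The limit flow and its right derivative\<close>

context projected_field
begin

text \<open>The estimates for the Euler paths pass to the pointwise limit along the subsequence; the
  mesh terms vanish, and so does the distance between path and limit at the starting time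
  \<open>s\<close>.\<close>

lemma euler_limit:
  assumes x0: "x0 \<in> K"
  obtains u where "u 0 = x0" "\<And>t. u t \<in> K"
    "\<And>s t. norm (u t - u s) \<le> M * \<bar>t - s\<bar>"
    "\<And>s t v. 0 \<le> s \<Longrightarrow> s \<le> t \<Longrightarrow> v \<in> K \<Longrightarrow> (norm (u t - v))\<^sup>2 \<le> (norm (u s - v))\<^sup>2
      + (t - s) * (2 * (F (u s) \<bullet> (u s - v)) + 2 * (L * D + M) * ((t - s) * M))"
    "\<And>s t P. 0 \<le> s \<Longrightarrow> s \<le> t \<Longrightarrow> 0 \<le> P \<Longrightarrow>
      (\<And>x. x \<in> K \<Longrightarrow> F (u s) \<bullet> (x - u s) \<le> P * norm (x - u s)) \<Longrightarrow>
      norm (u t - u s) \<le> exp (L * (t - s)) * ((t - s) * P)"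
proof -
  obtain \<sigma> u where \<sigma>: "strict_mono \<sigma>" and u: "\<And>t. (\<lambda>n. euler_path x0 (\<sigma> n) t) \<longlonglongrightarrow> u t"
    using euler_paths_converge[OF x0] by blast
  have uK: "u t \<in> K" for t
    by (rule closed_sequentially[OF closed_K _ u]) (rule euler_path_in[OF x0])
  have h0: "(\<lambda>n. 1 / real (Suc (\<sigma> n))) \<longlonglongrightarrow> 0"
    using LIMSEQ_subseq_LIMSEQ[OF LIMSEQ_Suc[OF lim_1_over_n] \<sigma>] by (simp add: o_def)
  have u0: "u 0 = x0"
    using u[of 0] by (simp add: euler_path_def LIMSEQ_const_iff)
  have lip: "norm (u t - u s) \<le> M * \<bar>t - s\<bar>" for s t
  proof (rule tendsto_le[OF trivial_limit_sequentially])
    show "(\<lambda>n. norm (euler_path x0 (\<sigma> n) t - euler_path x0 (\<sigma> n) s)) \<longlonglongrightarrow> norm (u t - u s)"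
      by (intro tendsto_intros u)
    have "(\<lambda>n. (\<bar>t - s\<bar> + 1 / real (Suc (\<sigma> n))) * M) \<longlonglongrightarrow> (\<bar>t - s\<bar> + 0) * M"
      by (intro tendsto_intros h0)
    then show "(\<lambda>n. (\<bar>t - s\<bar> + 1 / real (Suc (\<sigma> n))) * M) \<longlonglongrightarrow> M * \<bar>t - s\<bar>"
      by (simp add: mult.commute)
    show "\<forall>\<^sub>F n in sequentially. norm (euler_path x0 (\<sigma> n) t - euler_path x0 (\<sigma> n) s)
        \<le> (\<bar>t - s\<bar> + 1 / real (Suc (\<sigma> n))) * M"
      using norm_euler_path_diff_le[OF x0] by simp
  qed
  have steps: "\<exists>k. (\<lambda>n. real (k n) * (1 / real (Suc (\<sigma> n)))) \<longlonglongrightarrow> t - s \<and>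
      (\<forall>n. euler_path x0 (\<sigma> n) t
        = (euler_step (1 / real (Suc (\<sigma> n))) ^^ k n) (euler_path x0 (\<sigma> n) s))"
    if "0 \<le> s" and st: "s \<le> t" for s t
  proof -
    have "\<exists>k. euler_path x0 n t = (euler_step (1 / real (Suc n)) ^^ k) (euler_path x0 n s) \<and>
        nat \<lfloor>t * real (Suc n)\<rfloor> = nat \<lfloor>s * real (Suc n)\<rfloor> + k" for n
      using euler_path_shift[OF st] by metis
    then obtain k where k: "\<And>n. euler_path x0 n t
        = (euler_step (1 / real (Suc n)) ^^ k n) (euler_path x0 n s)"
      and kn: "\<And>n. nat \<lfloor>t * real (Suc n)\<rfloor> = nat \<lfloor>s * real (Suc n)\<rfloor> + k n"
      by metis
    have "(\<lambda>n. real (nat \<lfloor>t * real (Suc n)\<rfloor>) * (1 / Suc n)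
        - real (nat \<lfloor>s * real (Suc n)\<rfloor>) * (1 / Suc n)) \<longlonglongrightarrow> t - s"
      using that by (intro tendsto_diff nat_floor_mult_Suc_div_tendsto) auto
    then have "(\<lambda>n. real (k n) * (1 / Suc n)) \<longlonglongrightarrow> t - s"
      by (simp add: kn add_divide_distrib del: of_nat_Suc)
    from LIMSEQ_subseq_LIMSEQ[OF this \<sigma>]
    have "(\<lambda>n. real (k (\<sigma> n)) * (1 / real (Suc (\<sigma> n)))) \<longlonglongrightarrow> t - s" by (simp add: o_def)
    then show ?thesis using k by (intro exI[of _ "\<lambda>n. k (\<sigma> n)"]) auto
  qed
  have var: "(norm (u t - v))\<^sup>2 \<le> (norm (u s - v))\<^sup>2
      + (t - s) * (2 * (F (u s) \<bullet> (u s - v)) + 2 * (L * D + M) * ((t - s) * M))"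
    if st: "0 \<le> s" "s \<le> t" and v: "v \<in> K" for s t v
  proof -
    obtain k where k: "(\<lambda>n. real (k n) * (1 / real (Suc (\<sigma> n)))) \<longlonglongrightarrow> t - s"
      and eq: "\<And>n. euler_path x0 (\<sigma> n) t
        = (euler_step (1 / real (Suc (\<sigma> n))) ^^ k n) (euler_path x0 (\<sigma> n) s)"
      using steps[OF st] by blast
    let ?h = "\<lambda>n. 1 / real (Suc (\<sigma> n))"
    let ?a = "\<lambda>n. euler_path x0 (\<sigma> n) s"
    \<comment> \<open>The field is frozen at the limit point \<open>u s\<close>, so no limit of
      values of \<open>F\<close> has to be taken.\<close>
    let ?R = "\<lambda>n. (norm (?a n - v))\<^sup>2 + real (k n) * ?h n * (2 * (F (u s) \<bullet> (u s - v))
        + 2 * (L * D + M) * (norm (?a n - u s) + real (k n) * ?h n * M) + ?h n * M\<^sup>2)"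
    have "?R \<longlonglongrightarrow> (norm (u s - v))\<^sup>2 + (t - s) * (2 * (F (u s) \<bullet> (u s - v))
        + 2 * (L * D + M) * (norm (u s - u s) + (t - s) * M) + 0 * M\<^sup>2)"
      by (intro tendsto_add tendsto_mult tendsto_power tendsto_norm tendsto_diff tendsto_const u k h0)
    moreover have "(\<lambda>n. (norm (euler_path x0 (\<sigma> n) t - v))\<^sup>2) \<longlonglongrightarrow> (norm (u t - v))\<^sup>2"
      by (intro tendsto_intros u)
    moreover have "(norm (euler_path x0 (\<sigma> n) t - v))\<^sup>2 \<le> ?R n" for n
      unfolding eq
      by (rule euler_iterate_variational[OF euler_path_in[OF x0] uK v _ order_refl]) simp
    ultimately show ?thesis
      by (fastforce dest: LIMSEQ_le)
  qed
  have speed: "norm (u t - u s) \<le> exp (L * (t - s)) * ((t - s) * P)"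
    if st: "0 \<le> s" "s \<le> t" and P: "0 \<le> P"
      "\<And>x. x \<in> K \<Longrightarrow> F (u s) \<bullet> (x - u s) \<le> P * norm (x - u s)" for s t P
  proof -
    obtain k where k: "(\<lambda>n. real (k n) * (1 / real (Suc (\<sigma> n)))) \<longlonglongrightarrow> t - s"
      and eq: "\<And>n. euler_path x0 (\<sigma> n) t
        = (euler_step (1 / real (Suc (\<sigma> n))) ^^ k n) (euler_path x0 (\<sigma> n) s)"
      using steps[OF st] by blast
    let ?h = "\<lambda>n. 1 / real (Suc (\<sigma> n))"
    let ?a = "\<lambda>n. euler_path x0 (\<sigma> n) s"
    let ?R = "\<lambda>n. exp (L * (real (k n) * ?h n)) * (norm (?a n - u s) + real (k n) * ?h n * P)"
    have "?R \<longlonglongrightarrow> exp (L * (t - s)) * (norm (u s - u s) + (t - s) * P)"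
      by (intro tendsto_add tendsto_mult tendsto_exp tendsto_norm tendsto_diff tendsto_const u k)
    moreover have "(\<lambda>n. norm (euler_path x0 (\<sigma> n) t - u s)) \<longlonglongrightarrow> norm (u t - u s)"
      by (intro tendsto_intros u)
    moreover have "norm (euler_path x0 (\<sigma> n) t - u s) \<le> ?R n" for n
      unfolding eq
      by (rule euler_iterate_speed[OF euler_path_in[OF x0] uK _ P]) simp_all
    ultimately show ?thesis
      by (fastforce dest: LIMSEQ_le)
  qed
  from that[OF u0 uK lip var speed] show ?thesis .
qed

lemma projected_flow_exists:
  assumes x0: "x0 \<in> K"
  obtains u u' where "u 0 = x0" "\<And>t. u t \<in> K"
    "\<And>s t. norm (u t - u s) \<le> M * \<bar>t - s\<bar>"
    "\<And>t. 0 \<le> t \<Longrightarrow> (\<lambda>n. real (Suc n) *\<^sub>R (u (t + 1 / Suc n) - u t)) \<longlonglongrightarrow> u' t"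
    "\<And>t v. 0 \<le> t \<Longrightarrow> v \<in> K \<Longrightarrow> (F (u t) - u' t) \<bullet> (v - u t) \<le> 0"
proof -
  obtain u where u0: "u 0 = x0" and uK: "\<And>t. u t \<in> K"
    and lip: "\<And>s t. norm (u t - u s) \<le> M * \<bar>t - s\<bar>"
    and var: "\<And>s t v. 0 \<le> s \<Longrightarrow> s \<le> t \<Longrightarrow> v \<in> K \<Longrightarrow> (norm (u t - v))\<^sup>2 \<le> (norm (u s - v))\<^sup>2
      + (t - s) * (2 * (F (u s) \<bullet> (u s - v)) + 2 * (L * D + M) * ((t - s) * M))"
    and speed: "\<And>s t P. 0 \<le> s \<Longrightarrow> s \<le> t \<Longrightarrow> 0 \<le> P \<Longrightarrow>
      (\<And>x. x \<in> K \<Longrightarrow> F (u s) \<bullet> (x - u s) \<le> P * norm (x - u s)) \<Longrightarrow>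
      norm (u t - u s) \<le> exp (L * (t - s)) * ((t - s) * P)"
    using euler_limit[OF x0] by blast
  \<comment> \<open>\<open>N p\<close> is the normal cone of \<open>K\<close> at \<open>p\<close>;
    as an intersection of half-spaces it is closed and convex, so the nearest point to
    \<open>F p\<close> is unique.\<close>
  define N where "N p = {z. \<forall>v\<in>K. z \<bullet> (v - p) \<le> 0}" for p
  have N: "closed (N p)" "convex (N p)" "0 \<in> N p" for p
  proof -
    have eq: "N p = (\<Inter>v\<in>K. {z. (v - p) \<bullet> z \<le> 0})" by (auto simp: N_def inner_commute)
    show "closed (N p)" "convex (N p)" unfolding eq
      by (auto intro!: closed_INT convex_INT closed_halfspace_le convex_halfspace_le)
    show "0 \<in> N p" by (simp add: N_def)
  qed
  \<comment> \<open>For \<open>p\<close> in \<open>K\<close>, the difference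
    \<open>F p - n p\<close> is the projection of the field onto the tangent cone, the expected
    velocity.\<close>
  define n where "n p = closest_point (N p) (F p)" for p
  have nN: "n p \<in> N p" for p
    unfolding n_def using N[of p] by (intro closest_point_in_set) auto
  have lim: "(\<lambda>k. real (Suc k) *\<^sub>R (u (t + 1 / Suc k) - u t)) \<longlonglongrightarrow> F (u t) - n (u t)"
    if t: "0 \<le> t" for t
  proof -
    define d where "d k = real (Suc k) *\<^sub>R (u (t + 1 / Suc k) - u t)" for k
    have "d \<longlonglongrightarrow> F (u t) - n (u t)"
    proof (rule bounded_tendsto_of_unique_limit_point)
      let ?p = "u t" and ?P = "norm (F (u t) - n (u t))"
      have ud: "u (t + 1 / real (Suc k)) = ?p + (1 / real (Suc k)) *\<^sub>R d k" for k
        by (simp add: d_def)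
      have "norm (d k) \<le> M" for k
      proof -
        have "norm (d k) = real (Suc k) * norm (u (t + 1 / Suc k) - u t)" by (simp add: d_def)
        also have "\<dots> \<le> real (Suc k) * (M * \<bar>t + 1 / Suc k - t\<bar>)"
          by (intro mult_left_mono lip) simp
        finally show ?thesis by simp
      qed
      then show "bounded (range d)" by (auto simp: bounded_iff)
      fix r l assume r: "strict_mono r" and l: "(d \<circ> r) \<longlonglongrightarrow> l"
      have h0: "(\<lambda>k. 1 / real (Suc (r k))) \<longlonglongrightarrow> 0"
        using LIMSEQ_subseq_LIMSEQ[OF LIMSEQ_Suc[OF lim_1_over_n] r] by (simp add: o_def)
      have dl: "(\<lambda>k. d (r k)) \<longlonglongrightarrow> l" using l by (simp add: o_def)
      have "F ?p - l \<in> N ?p"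
        unfolding N_def
      proof (intro CollectI ballI)
        fix v assume v: "v \<in> K"
        let ?C = "2 * (L * D + M) * M"
        \<comment> \<open>The variational inequality over the time \<open>1 / Suc k\<close>, with
          the square expanded: the nonnegative term in \<open>norm (d k)\<close> is dropped, and
          division by the elapsed time leaves an error of order \<open>1 / Suc k\<close>.\<close>
        have "2 * (d k \<bullet> (?p - v)) \<le> 2 * (F ?p \<bullet> (?p - v)) + ?C * (1 / Suc k)" for k
        proof -
          let ?h = "1 / real (Suc k)"
          have "(norm (?p - v))\<^sup>2 + ?h * (2 * (d k \<bullet> (?p - v))) + ?h\<^sup>2 * (norm (d k))\<^sup>2
              = (norm (?p + ?h *\<^sub>R d k - v))\<^sup>2"
          proof -
            have "(norm (?p + h *\<^sub>R d - v))\<^sup>2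
              = (norm (?p - v))\<^sup>2 + h * (2 * (d \<bullet> (?p - v))) + h\<^sup>2 * (norm d)\<^sup>2" for h d
              by (simp only: power2_norm_eq_inner power2_eq_square[of h])
                (simp add: algebra_simps inner_diff_left inner_diff_right inner_commute)
            then show ?thesis by metis
          qed
          also have "\<dots> \<le> (norm (?p - v))\<^sup>2
              + ?h * (2 * (F ?p \<bullet> (?p - v)) + 2 * (L * D + M) * (?h * M))"
            using var[OF t _ v, of "t + ?h"] unfolding ud by simp
          finally have "?h * (2 * (d k \<bullet> (?p - v))) \<le>
              ?h * (2 * (F ?p \<bullet> (?p - v)) + 2 * (L * D + M) * (?h * M))"
            using zero_le_power2[of "?h * norm (d k)"] by (simp only: power_mult_distrib)
          then have "2 * (d k \<bullet> (?p - v)) \<le> 2 * (F ?p \<bullet> (?p - v)) + 2 * (L * D + M) * (?h * M)"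
            by (rule mult_left_le_imp_le) simp
          then show ?thesis by (simp only: mult_ac)
        qed
        then have ineq: "\<forall>k. 2 * (d (r k) \<bullet> (?p - v))
            \<le> 2 * (F ?p \<bullet> (?p - v)) + ?C * (1 / real (Suc (r k)))" by blast
        have lhs: "(\<lambda>k. 2 * (d (r k) \<bullet> (?p - v))) \<longlonglongrightarrow> 2 * (l \<bullet> (?p - v))"
          by (intro tendsto_intros dl)
        have rhs: "(\<lambda>k. 2 * (F ?p \<bullet> (?p - v)) + ?C * (1 / real (Suc (r k))))
            \<longlonglongrightarrow> 2 * (F ?p \<bullet> (?p - v)) + ?C * 0"
          by (intro tendsto_add tendsto_mult tendsto_const h0)
        have "2 * (l \<bullet> (?p - v)) \<le> 2 * (F ?p \<bullet> (?p - v)) + ?C * 0"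
          using LIMSEQ_le[OF lhs rhs] ineq by blast
        then show "(F ?p - l) \<bullet> (v - ?p) \<le> 0"
          by (simp add: inner_diff_left inner_diff_right)
      qed
      moreover have "norm l \<le> ?P"
      proof -
        \<comment> \<open>The normal vector \<open>n ?p\<close> has nonpositive inner product with
          \<open>x - ?p\<close>, so subtracting it from the field only increases the left side.
          Hence \<open>?P\<close> is admissible in the speed bound.\<close>
        have P: "F ?p \<bullet> (x - ?p) \<le> ?P * norm (x - ?p)" if "x \<in> K" for x
        proof -
          have "n ?p \<bullet> (x - ?p) \<le> 0" using nN that by (auto simp: N_def)
          then show ?thesis
            using norm_cauchy_schwarz[of "F ?p - n ?p" "x - ?p"] by (simp add: inner_diff_left)
        qed
        have "norm (d k) \<le> exp (L * (1 / Suc k)) * ?P" for k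
        proof -
          have "norm (u (t + 1 / Suc k) - ?p) \<le> exp (L * (1 / Suc k)) * (1 / Suc k * ?P)"
            using speed[OF t _ _ P, of "t + 1 / Suc k"] by simp
          from mult_left_mono[OF this, of "real (Suc k)"] show ?thesis by (simp add: d_def)
        qed
        then have ineq: "\<forall>k. norm (d (r k)) \<le> exp (L * (1 / real (Suc (r k)))) * ?P" by blast
        have rhs: "(\<lambda>k. exp (L * (1 / real (Suc (r k)))) * ?P) \<longlonglongrightarrow> exp (L * 0) * ?P"
          by (intro tendsto_mult tendsto_exp tendsto_const h0)
        have lhs: "(\<lambda>k. norm (d (r k))) \<longlonglongrightarrow> norm l" by (intro tendsto_norm dl)
        have "norm l \<le> exp (L * 0) * ?P" using LIMSEQ_le[OF lhs rhs] ineq by blast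
        then show ?thesis by simp
      qed
      \<comment> \<open>\<open>norm l\<close> is the distance from \<open>F ?p\<close> to
        \<open>F ?p - l\<close>, so this element of the cone is at least as near to
        \<open>F ?p\<close> as \<open>n ?p\<close>, and the nearest point is unique.\<close>
      ultimately have "F ?p - l = n ?p"
      proof -
        assume 1: "F ?p - l \<in> N ?p" and 2: "norm l \<le> ?P"
        have "dist (F ?p) (F ?p - l) \<le> dist (F ?p) z" if "z \<in> N ?p" for z
          using closest_point_le[OF N(1) that, of "F ?p"] 2 by (simp add: dist_norm n_def)
        then show ?thesis
          unfolding n_def by (intro closest_point_unique N 1) auto
      qed
      then show "l = F ?p - n ?p" by (auto simp: algebra_simps)
    qed
    then show ?thesis by (simp add: d_def[abs_def])
  qed
  have "(F (u t) - (F (u t) - n (u t))) \<bullet> (v - u t) \<le> 0" if "v \<in> K" for t v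
    using nN[of "u t"] that by (simp add: N_def)
  then show ?thesis by (intro that[of u "\<lambda>t. F (u t) - n (u t)"] u0 uK lip lim) auto
qed

end

section \<open>Weak derivatives from one-sided difference quotients\<close>

lemma integrable_continuous_compact_support:
  fixes k :: "real \<Rightarrow> real"
  assumes "continuous_on UNIV k" "\<And>t. t \<notin> {p..q} \<Longrightarrow> k t = 0"
  shows "integrable lborel k"
proof -
  have "integrable lborel (\<lambda>t. indicator {p..q} t *\<^sub>R k t)"
    using assms(1) by (intro borel_integrable_compact) (auto intro: continuous_on_subset)
  moreover have "(\<lambda>t. indicator {p..q} t *\<^sub>R k t) = k"
    using assms(2) by (auto simp: indicator_def fun_eq_iff)
  ultimately show ?thesis by simp
qed

text \<open>Collects what the limit argument uses of a test function: a continuous derivative of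
  compact support and a global Lipschitz constant.\<close>

lemma test_fun_properties:
  assumes "test_fun a b \<phi>"
  obtains c d B where "a < c" "c \<le> d" "d < b" "\<And>x. x \<notin> {c..d} \<Longrightarrow> \<phi> x = 0"
    "\<And>x. (\<phi> has_field_derivative deriv \<phi> x) (at x)" "continuous_on UNIV (deriv \<phi>)"
    "\<And>x. x \<notin> {c..d} \<Longrightarrow> deriv \<phi> x = 0"
    "0 \<le> B" "\<And>x y. \<bar>\<phi> x - \<phi> y\<bar> \<le> B * \<bar>x - y\<bar>"
proof -
  obtain c d where cd: "a < c" "c \<le> d" "d < b" and \<phi>0: "\<And>x. x \<notin> {c..d} \<Longrightarrow> \<phi> x = 0"
    using assms by (auto simp: test_fun_def)
  have diff: "((deriv ^^ k) \<phi>) differentiable (at x)" for k x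
    using assms by (simp add: test_fun_def smooth_fun_def)
  have der: "(\<phi> has_field_derivative deriv \<phi> x) (at x)" for x
    using diff[of 0 x] by (simp add: DERIV_deriv_iff_real_differentiable)
  have cont: "continuous_on UNIV (deriv \<phi>)"
    using diff[of 1] by (auto intro!: continuous_at_imp_continuous_on differentiable_imp_continuous_within)
  have d0: "deriv \<phi> x = 0" if "x \<notin> {c..d}" for x
  proof -
    have "(\<phi> has_field_derivative 0) (at x)"
      by (rule has_field_derivative_transform_within_open[of "\<lambda>_. 0" _ _ "- {c..d}"])
        (use that \<phi>0 in auto)
    then show ?thesis by (rule DERIV_imp_deriv)
  qed
  have "compact (deriv \<phi> ` {c..d})"
    using cont by (intro compact_continuous_image) (auto intro: continuous_on_subset)
  then obtain B where B: "0 < B" "\<And>x. x \<in> {c..d} \<Longrightarrow> \<bar>deriv \<phi> x\<bar> \<le> B"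
    using bounded_pos[of "deriv \<phi> ` {c..d}"] compact_imp_bounded by auto
  have B': "\<bar>deriv \<phi> x\<bar> \<le> B" for x
    using B d0[of x] by (cases "x \<in> {c..d}") auto
  have "\<bar>\<phi> x - \<phi> y\<bar> \<le> B * \<bar>x - y\<bar>" for x y
    using field_differentiable_bound[of UNIV \<phi> "deriv \<phi>" B x y] der B' by simp
  with cd \<phi>0 der cont d0 B(1) show ?thesis by (intro that[of c d B]) auto
qed

text \<open>Translation invariance of Lebesgue measure moves the forward quotient of
  \<open>f\<close> to a backward quotient of the test function. Lipschitz constants bound both
  quotients, so dominated convergence applies on each side.\<close>

lemma weak_deriv_on_difference_quotients:
  fixes f g :: "real \<Rightarrow> real"
  assumes lip: "\<And>s t. \<bar>f t - f s\<bar> \<le> C * \<bar>t - s\<bar>"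
    and lim: "\<And>t. t \<in> {a<..<b} \<Longrightarrow> (\<lambda>n. real (Suc n) * (f (t + 1 / Suc n) - f t)) \<longlonglongrightarrow> g t"
  shows "weak_deriv_on a b f g"
proof -
  have C: "0 \<le> C" using lip[of 1 0] by simp
  have cont_f: "continuous_on UNIV f"
    by (rule lipschitz_on_continuous_on[of C]) (auto intro!: lipschitz_onI simp: dist_real_def lip C)
  have f_meas[measurable]: "f \<in> borel_measurable borel"
    using cont_f by (rule borel_measurable_continuous_onI)
  \<comment> \<open>\<open>g\<close> is arbitrary outside the interval; its truncation
    \<open>G\<close> is a pointwise limit of measurable functions bounded by
    \<open>C\<close>.\<close>
  define G where "G t = indicator {a<..<b} t * g t" for t
  define Q where "Q n t = real (Suc n) * (f (t + 1 / Suc n) - f t)" for n t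
  have Q_le: "\<bar>Q n t\<bar> \<le> C" for n t
  proof -
    have "\<bar>Q n t\<bar> = real (Suc n) * \<bar>f (t + 1 / Suc n) - f t\<bar>"
      by (simp add: Q_def abs_mult)
    also have "\<dots> \<le> real (Suc n) * (C * \<bar>t + 1 / Suc n - t\<bar>)"
      by (intro mult_left_mono lip) simp
    finally show ?thesis by simp
  qed
  have Q_meas[measurable]: "Q n \<in> borel_measurable borel" for n
    unfolding Q_def by measurable
  have Q_lim: "(\<lambda>n. indicator {a<..<b} t * Q n t) \<longlonglongrightarrow> G t" for t
    using lim[of t] by (cases "t \<in> {a<..<b}") (auto simp: G_def Q_def)
  have G_meas[measurable]: "G \<in> borel_measurable borel"
    by (rule borel_measurable_LIMSEQ_real[OF Q_lim]) measurable
  have G_le: "\<bar>G t\<bar> \<le> C" for t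
  proof (rule Lim_bounded)
    show "(\<lambda>n. \<bar>indicator {a<..<b} t * Q n t\<bar>) \<longlonglongrightarrow> \<bar>G t\<bar>"
      by (intro tendsto_rabs Q_lim)
    show "\<forall>n\<ge>0. \<bar>indicator {a<..<b} t * Q n t\<bar> \<le> C"
      using Q_le C by (auto simp: indicator_def)
  qed
  have "L2_on a b f"
  proof -
    have "set_integrable lborel {a..b} (\<lambda>t. (f t)\<^sup>2)"
      unfolding set_integrable_def using cont_f
      by (intro borel_integrable_compact continuous_intros) (auto intro: continuous_on_subset)
    then have "set_integrable lborel {a<..<b} (\<lambda>t. (f t)\<^sup>2)"
      by (rule set_integrable_subset) auto
    then show ?thesis by (simp add: L2_on_def)
  qed
  moreover have "L2_on a b g"
  proof -
    have "integrable lborel (\<lambda>t. (G t)\<^sup>2)"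
    proof (rule integrableI_bounded_set[where A = "{a<..<b}" and B = "C\<^sup>2"])
      show "AE t in lborel. t \<in> {a<..<b} \<longrightarrow> norm ((G t)\<^sup>2) \<le> C\<^sup>2"
        using G_le C by (auto intro!: AE_I2 simp: abs_le_square_iff[symmetric])
      show "emeasure lborel {a<..<b} < \<infinity>" by (cases "a \<le> b") auto
      show "(\<lambda>t. (G t)\<^sup>2) \<in> borel_measurable lborel" by simp
    qed (use G_meas in \<open>auto simp: G_def\<close>)
    moreover have "(\<lambda>t. (G t)\<^sup>2) = (\<lambda>t. indicator {a<..<b} t *\<^sub>R (g t)\<^sup>2)"
      by (auto simp: G_def indicator_def)
    ultimately show ?thesis
      using G_meas by (simp add: L2_on_def set_integrable_def G_def[abs_def])
  qed
  moreover have "(LINT t:{a<..<b}|lborel. f t * deriv \<phi> t) = - (LINT t:{a<..<b}|lborel. g t * \<phi> t)"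
    if tf: "test_fun a b \<phi>" for \<phi>
  proof -
    obtain c d B where cd: "a < c" "c \<le> d" "d < b" and \<phi>0: "\<And>x. x \<notin> {c..d} \<Longrightarrow> \<phi> x = 0"
      and der: "\<And>x. (\<phi> has_field_derivative deriv \<phi> x) (at x)"
      and cont: "continuous_on UNIV (deriv \<phi>)"
      and d0: "\<And>x. x \<notin> {c..d} \<Longrightarrow> deriv \<phi> x = 0"
      and B: "0 \<le> B" "\<And>x y. \<bar>\<phi> x - \<phi> y\<bar> \<le> B * \<bar>x - y\<bar>"
      using that by (rule test_fun_properties[OF tf])
    have cont_\<phi>: "continuous_on UNIV \<phi>"
      using der by (auto intro!: continuous_at_imp_continuous_on DERIV_isCont)
    have [measurable]: "\<phi> \<in> borel_measurable borel" "deriv \<phi> \<in> borel_measurable borel"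
      using cont_\<phi> cont by (auto intro: borel_measurable_continuous_onI)
    define R where "R n t = real (Suc n) * (\<phi> t - \<phi> (t - 1 / Suc n))" for n t
    have R_meas[measurable]: "R n \<in> borel_measurable borel" for n
      unfolding R_def by measurable
    have R_le: "\<bar>R n t\<bar> \<le> B" for n t
    proof -
      have "\<bar>R n t\<bar> = real (Suc n) * \<bar>\<phi> t - \<phi> (t - 1 / Suc n)\<bar>"
        by (simp add: R_def abs_mult)
      also have "\<dots> \<le> real (Suc n) * (B * \<bar>t - (t - 1 / Suc n)\<bar>)"
        by (intro mult_left_mono B) simp
      finally show ?thesis by simp
    qed
    \<comment> \<open>The shift \<open>1 / Suc n\<close> is at most 1, so all quotients are
      supported in one compact interval, on which \<open>f\<close> is bounded.\<close>
    have R0: "R n t = 0" if "t \<notin> {c..d + 1}" for n t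
    proof -
      have "t - h \<notin> {c..d}" if "0 \<le> h" "h \<le> 1" for h
        using \<open>t \<notin> {c..d + 1}\<close> that by auto
      from this[of 0] this[of "1 / Suc n"] show ?thesis using \<phi>0 by (simp add: R_def)
    qed
    have R_lim: "(\<lambda>n. R n t) \<longlonglongrightarrow> deriv \<phi> t" for t
    proof -
      \<comment> \<open>\<open>R n t\<close> is the difference quotient of \<open>\<phi>\<close>
        with a negative increment, which tends to 0 without vanishing.\<close>
      have h0: "(\<lambda>n. - (1 / real (Suc n))) \<longlonglongrightarrow> - 0"
        by (intro tendsto_minus LIMSEQ_Suc[OF lim_1_over_n])
      have "filterlim (\<lambda>n. - (1 / real (Suc n))) (at 0) sequentially"
        using h0 by (auto simp: filterlim_at simp del: of_nat_Suc)
      from filterlim_compose[OF der[of t, unfolded DERIV_def] this] show ?thesis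
        by (simp add: R_def field_simps)
    qed
    have "compact (f ` {c..d + 1})"
      using cont_f by (intro compact_continuous_image) (auto intro: continuous_on_subset)
    then obtain Bf where Bf: "0 < Bf" "\<And>x. x \<in> {c..d + 1} \<Longrightarrow> \<bar>f x\<bar> \<le> Bf"
      using bounded_pos[of "f ` {c..d + 1}"] compact_imp_bounded by auto
    have "compact (\<phi> ` {c..d})"
      using cont_\<phi> by (intro compact_continuous_image) (auto intro: continuous_on_subset)
    then obtain B\<phi> where B\<phi>: "0 < B\<phi>" "\<And>x. x \<in> {c..d} \<Longrightarrow> \<bar>\<phi> x\<bar> \<le> B\<phi>"
      using bounded_pos[of "\<phi> ` {c..d}"] compact_imp_bounded by auto
    have lim1: "(\<lambda>n. LINT t|lborel. f t * R n t) \<longlonglongrightarrow> (LINT t|lborel. f t * deriv \<phi> t)"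
    proof (rule integral_dominated_convergence[where w = "\<lambda>t. indicator {c..d + 1} t * (Bf * B)"])
      show "integrable lborel (\<lambda>t. indicator {c..d + 1} t * (Bf * B))"
        using cd by (intro integrable_mult_left integrable_real_indicator) auto
      show "AE t in lborel. (\<lambda>n. f t * R n t) \<longlonglongrightarrow> f t * deriv \<phi> t"
        by (intro AE_I2 tendsto_intros R_lim)
      show "AE t in lborel. norm (f t * R n t) \<le> indicator {c..d + 1} t * (Bf * B)" for n
      proof (intro AE_I2)
        fix t
        show "norm (f t * R n t) \<le> indicator {c..d + 1} t * (Bf * B)"
          using Bf R_le[of n t] R0[of t n] by (cases "t \<in> {c..d + 1}") (auto simp: abs_mult intro!: mult_mono)
      qed
    qed auto
    have lim2: "(\<lambda>n. LINT t|lborel. Q n t * \<phi> t) \<longlonglongrightarrow> (LINT t|lborel. G t * \<phi> t)"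
    proof (rule integral_dominated_convergence[where w = "\<lambda>t. indicator {c..d} t * (C * B\<phi>)"])
      show "integrable lborel (\<lambda>t. indicator {c..d} t * (C * B\<phi>))"
        using cd by (intro integrable_mult_left integrable_real_indicator) auto
      \<comment> \<open>Convergence of the quotients is known only inside the interval; outside it
        the test function vanishes.\<close>
      show "AE t in lborel. (\<lambda>n. Q n t * \<phi> t) \<longlonglongrightarrow> G t * \<phi> t"
      proof (intro AE_I2)
        fix t
        show "(\<lambda>n. Q n t * \<phi> t) \<longlonglongrightarrow> G t * \<phi> t"
        proof (cases "t \<in> {a<..<b}")
          case True
          then show ?thesis using Q_lim[of t] by (intro tendsto_intros) simp
        next
          case False
          then have "\<phi> t = 0" using cd by (intro \<phi>0) auto
          then show ?thesis by simp
        qed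
      qed
      show "AE t in lborel. norm (Q n t * \<phi> t) \<le> indicator {c..d} t * (C * B\<phi>)" for n
      proof (intro AE_I2)
        fix t
        show "norm (Q n t * \<phi> t) \<le> indicator {c..d} t * (C * B\<phi>)"
          using B\<phi> Q_le[of n t] \<phi>0[of t] C by (cases "t \<in> {c..d}") (auto simp: abs_mult intro!: mult_mono)
      qed
    qed auto
    \<comment> \<open>Discrete integration by parts: the quotient is split and one of the two
      integrals is shifted by \<open>h\<close>.\<close>
    have eq: "(LINT t|lborel. f t * R n t) = - (LINT t|lborel. Q n t * \<phi> t)" for n
    proof -
      define h where "h = 1 / real (Suc n)"
      have i1: "integrable lborel (\<lambda>t. f t * \<phi> t)"
        using \<phi>0 by (intro integrable_continuous_compact_support[of _ c d] continuous_intros cont_f cont_\<phi>) auto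
      have i2: "integrable lborel (\<lambda>t. f t * \<phi> (t - h))"
        by (rule integrable_continuous_compact_support[of _ "c + h" "d + h"])
          (auto intro!: continuous_intros continuous_on_compose2[OF cont_\<phi>] cont_f \<phi>0)
      have i3: "integrable lborel (\<lambda>t. f (t + h) * \<phi> t)"
        using \<phi>0 by (intro integrable_continuous_compact_support[of _ c d] continuous_intros
            continuous_on_compose2[OF cont_f] cont_\<phi>) auto
      have shift: "(LINT t|lborel. f t * \<phi> (t - h)) = (LINT t|lborel. f (t + h) * \<phi> t)"
        using lborel_integral_real_affine[of 1 "\<lambda>t. f t * \<phi> (t - h)" h] by (simp add: add.commute)
      have "(LINT t|lborel. f t * R n t)
          = (LINT t|lborel. real (Suc n) * (f t * \<phi> t - f t * \<phi> (t - h)))"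
        by (simp add: R_def h_def algebra_simps)
      also have "\<dots> = real (Suc n) * ((LINT t|lborel. f t * \<phi> t) - (LINT t|lborel. f (t + h) * \<phi> t))"
        using i1 i2 shift by simp
      also have "\<dots> = (LINT t|lborel. real (Suc n) * (f t * \<phi> t - f (t + h) * \<phi> t))"
        using i1 i3 by simp
      also have "\<dots> = (LINT t|lborel. - (Q n t * \<phi> t))"
        by (simp add: Q_def h_def algebra_simps)
      finally show ?thesis by simp
    qed
    have "(LINT t|lborel. f t * deriv \<phi> t) = - (LINT t|lborel. G t * \<phi> t)"
      using LIMSEQ_unique[OF lim1] tendsto_minus[OF lim2] by (simp add: eq)
    moreover have "(\<lambda>t. indicator {a<..<b} t *\<^sub>R (f t * deriv \<phi> t)) = (\<lambda>t. f t * deriv \<phi> t)"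
    proof
      fix t show "indicator {a<..<b} t *\<^sub>R (f t * deriv \<phi> t) = f t * deriv \<phi> t"
        using d0[of t] cd by (cases "t \<in> {a<..<b}") auto
    qed
    moreover have "(\<lambda>t. indicator {a<..<b} t *\<^sub>R (g t * \<phi> t)) = (\<lambda>t. G t * \<phi> t)"
      by (simp add: G_def mult.assoc)
    ultimately show ?thesis by (simp add: set_lebesgue_integral_def)
  qed
  ultimately show ?thesis by (simp add: weak_deriv_on_def)
qed

section \<open>The double-obstacle flow\<close>

text \<open>Moving mass from \<open>j\<close> to \<open>i\<close> is admissible when \<open>u j > 0\<close> and \<open>u i < 1\<close>, so then
  \<open>q j \<le> q i\<close>; any constant separating these values is the multiplier.\<close>

lemma Bset_exchange:
  fixes m q u :: "'v::finite \<Rightarrow> real"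
  assumes m: "\<And>i. 0 < m i" and box: "in_box u"
    and vi: "\<And>v. in_box v \<Longrightarrow> (\<Sum>i\<in>UNIV. v i * m i) = (\<Sum>i\<in>UNIV. u i * m i)
      \<Longrightarrow> 0 \<le> (\<Sum>i\<in>UNIV. m i * q i * (v i - u i))"
  shows "\<exists>c. (\<lambda>i. q i + c) \<in> Bset u"
proof -
  have u: "0 \<le> u i" "u i \<le> 1" for i using box by (auto simp: in_box_def)
  have le: "q j \<le> q i" if i: "u i < 1" and j: "0 < u j" and "i \<noteq> j" for i j
  proof -
    \<comment> \<open>\<open>s\<close> is the largest mass that can move from \<open>j\<close> to
      \<open>i\<close> within the box; dividing it by the weights converts mass into values and
      preserves the total.\<close>
    define s where "s = min ((1 - u i) * m i) (u j * m j)"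
    have s: "0 < s" "s / m i \<le> 1 - u i" "s / m j \<le> u j"
      using i j m[of i] m[of j] by (auto simp: s_def divide_le_eq min_def)
    define v where "v k = u k + ((if k = i then s / m i else 0) - (if k = j then s / m j else 0))" for k
    have "0 < s / m i" "0 < s / m j" using s(1) m by auto
    then have "in_box v"
      using s u \<open>i \<noteq> j\<close> by (auto simp: in_box_def v_def) (smt (verit) u)+
    moreover have "(\<Sum>k\<in>UNIV. v k * m k) = (\<Sum>k\<in>UNIV. u k * m k)"
    proof -
      have "(\<Sum>k\<in>UNIV. v k * m k) = (\<Sum>k\<in>UNIV. u k * m k
          + ((if k = i then s / m i * m i else 0) - (if k = j then s / m j * m j else 0)))"
        by (intro sum.cong) (auto simp: v_def algebra_simps)
      also have "\<dots> = (\<Sum>k\<in>UNIV. u k * m k) + (s / m i * m i - s / m j * m j)"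
        by (simp only: sum.distrib sum_subtractf sum.delta finite UNIV_I if_True)
      finally show ?thesis using m[of i] m[of j] by simp
    qed
    ultimately have "0 \<le> (\<Sum>k\<in>UNIV. m k * q k * (v k - u k))" by (rule vi)
    also have "\<dots> = (\<Sum>k\<in>UNIV. (if k = i then m i * q i * (s / m i) else 0)
        - (if k = j then m j * q j * (s / m j) else 0))"
      by (intro sum.cong) (auto simp: v_def algebra_simps)
    also have "\<dots> = m i * q i * (s / m i) - m j * q j * (s / m j)"
      by (simp only: sum_subtractf sum.delta finite UNIV_I if_True)
    also have "\<dots> = s * (q i - q j)" using m[of i] m[of j] by (simp add: field_simps)
    finally show ?thesis using s(1) by (simp add: zero_le_mult_iff)
  qed
  show ?thesis
  proof (cases "\<exists>j. 0 < u j")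
    case False
    then have u0: "u i = 0" for i using u[of i] by (metis less_eq_real_def)
    \<comment> \<open>At the zero state \<open>Bset\<close> asks only for nonnegativity, so
      subtracting the smallest value of \<open>q\<close> suffices.\<close>
    define \<mu> where "\<mu> = Min (range q)"
    have "\<mu> \<le> q i" for i by (simp add: \<mu>_def)
    then show ?thesis
      using box by (intro exI[of _ "- \<mu>"]) (auto simp: Bset_def u0)
  next
    case True
    \<comment> \<open>The multiplier is the largest \<open>q\<close> over the vertices that carry
      mass. It bounds \<open>q\<close> from above where \<open>u\<close> is positive; exchange with
      a maximizing vertex bounds \<open>q\<close> from below where \<open>u\<close> is less than
      1.\<close>
    define J where "J = q ` {j. 0 < u j}"
    have J: "finite J" "J \<noteq> {}" using True by (auto simp: J_def)
    obtain j0 where j0: "0 < u j0" "q j0 = Max J"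
      using Max_in[OF J] by (auto simp: J_def)
    have up: "q i \<le> Max J" if "0 < u i" for i
      using J(1) that by (intro Max_ge) (auto simp: J_def)
    have down: "Max J \<le> q i" if "u i < 1" for i
      using le[OF that j0(1)] j0(2) by (cases "i = j0") auto
    show ?thesis
    proof (intro exI[of _ "- Max J"])
      have "q i + - Max J = 0" if "0 < u i" "u i < 1" for i
        using up[OF that(1)] down[OF that(2)] by simp
      then show "(\<lambda>i. q i + - Max J) \<in> Bset u"
        using box up down by (auto simp: Bset_def)
    qed
  qed
qed

text \<open>The coordinates \<open>sqrt (a i) * u i\<close> turn the weighted inner product into the Euclidean one.\<close>

lemma box_flow_exists:
  fixes a b u0 :: "'v::finite \<Rightarrow> real" and F :: "('v \<Rightarrow> real) \<Rightarrow> 'v \<Rightarrow> real"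
  assumes a: "\<And>i. 0 < a i"
    and F_add: "\<And>x y i. F (\<lambda>j. x j + y j) i = F x i + F y i"
    and F_scale: "\<And>c x i. F (\<lambda>j. c * x j) i = c * F x i"
    and box0: "in_box u0"
  obtains u u' C where "u 0 = u0" "\<And>t. in_box (u t)"
    "\<And>t. (\<Sum>i\<in>UNIV. u t i * b i) = (\<Sum>i\<in>UNIV. u0 i * b i)"
    "\<And>s t i. \<bar>u t i - u s i\<bar> \<le> C i * \<bar>t - s\<bar>"
    "\<And>t i. 0 \<le> t \<Longrightarrow> (\<lambda>n. real (Suc n) * (u (t + 1 / Suc n) i - u t i)) \<longlonglongrightarrow> u' t i"
    "\<And>t v. 0 \<le> t \<Longrightarrow> in_box v \<Longrightarrow> (\<Sum>i\<in>UNIV. v i * b i) = (\<Sum>i\<in>UNIV. u0 i * b i)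
      \<Longrightarrow> (\<Sum>i\<in>UNIV. a i * (F (u t) i - u' t i) * (v i - u t i)) \<le> 0"
proof -
  define S where "S i = sqrt (a i)" for i
  have S: "0 < S i" "S i * S i = a i" for i using a[of i] by (auto simp: S_def)
  then have S0: "S i \<noteq> 0" for i by (metis less_irrefl)
  \<comment> \<open>\<open>up\<close> applies the rescaling and \<open>lo\<close> undoes it;
    \<open>K\<close> and \<open>G\<close> below are the admissible set and the field in the new
    coordinates.\<close>
  define lo where "lo y = (\<lambda>i. y $ i / S i)" for y :: "real ^ 'v"
  define up where "up x = (\<chi> i. S i * x i)" for x :: "'v \<Rightarrow> real"
  have lo_up: "lo (up x) = x" for x by (simp add: lo_def up_def S0)
  define m0 where "m0 = (\<Sum>i\<in>UNIV. u0 i * b i)"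
  define K where "K = {y. in_box (lo y) \<and> (\<Sum>i\<in>UNIV. lo y i * b i) = m0}"
  define G where "G y = (\<chi> i. S i * F (lo y) i)" for y
  have "linear G"
  proof (rule linearI)
    show "G (x + y) = G x + G y" for x y
      using F_add[of "lo x" "lo y"] by (simp add: G_def vec_eq_iff lo_def add_divide_distrib distrib_left)
    show "G (c *\<^sub>R x) = c *\<^sub>R G x" for c x
      using F_scale[of c "lo x"] by (simp add: G_def vec_eq_iff lo_def)
  qed
  then obtain B where B: "0 < B" "\<And>x. norm (G x) \<le> B * norm x"
    using linear_bounded_pos by blast
  \<comment> \<open>Points of \<open>K\<close> have coordinates between 0 and \<open>S i\<close>, so
    their norm is at most the sum \<open>R\<close>. Linearity of \<open>G\<close> then gives the
    Lipschitz constant \<open>B\<close> and the bound \<open>B * R\<close>.\<close>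
  define R where "R = (\<Sum>i\<in>UNIV. S i)"
  have R: "0 \<le> R" unfolding R_def using S(1) by (intro sum_nonneg) (simp add: less_imp_le)
  have K_norm: "norm y \<le> R" if "y \<in> K" for y
  proof -
    have "\<bar>y $ i\<bar> \<le> S i" for i
      using that S(1)[of i] by (auto simp: K_def in_box_def lo_def divide_le_eq zero_le_divide_iff abs_le_iff
          dest!: spec[of _ i])
    then show ?thesis
      unfolding R_def using norm_le_l1_cart[of y] sum_mono[of UNIV "\<lambda>i. \<bar>y $ i\<bar>" S] by fastforce
  qed
  interpret projected_field K G B "B * R" "R + R"
  proof
    show "closed K"
      unfolding K_def in_box_def lo_def
      by (intro closed_Collect_conj closed_Collect_all closed_Collect_le closed_Collect_eq continuous_intros)
        (simp_all add: S0)
    show "convex K"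
    proof (rule convexI)
      fix x y :: "real ^ 'v" and p q :: real
      assume x: "x \<in> K" and y: "y \<in> K" and pq: "0 \<le> p" "0 \<le> q" "p + q = 1"
      have eq: "lo (p *\<^sub>R x + q *\<^sub>R y) i = p * lo x i + q * lo y i" for i
        by (simp add: lo_def add_divide_distrib)
      have "p * lo x i + q * lo y i \<le> p * 1 + q * 1" "0 \<le> p * lo x i + q * lo y i" for i
        using x y pq(1,2)
        by (auto simp: K_def in_box_def simp del: mult_1_right intro!: add_mono mult_left_mono add_nonneg_nonneg)
      moreover have "(\<Sum>i\<in>UNIV. (p * lo x i + q * lo y i) * b i)
          = p * (\<Sum>i\<in>UNIV. lo x i * b i) + q * (\<Sum>i\<in>UNIV. lo y i * b i)"
        by (simp add: sum_distrib_left sum.distrib algebra_simps)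
      moreover have "p * m0 + q * m0 = m0" using pq(3) by (simp add: distrib_right[symmetric])
      ultimately show "p *\<^sub>R x + q *\<^sub>R y \<in> K"
        using x y pq(3) by (simp add: K_def in_box_def eq)
    qed
    show "norm (G x) \<le> B * R" if "x \<in> K" for x
      using order_trans[OF B(2) mult_left_mono[OF K_norm[OF that]]] B(1) by simp
    show "norm (G x - G y) \<le> B * norm (x - y)" for x y
      using B(2)[of "x - y"] linear_diff[OF \<open>linear G\<close>] by simp
    show "norm (x - y) \<le> R + R" if "x \<in> K" "y \<in> K" for x y
      using K_norm[OF that(1)] K_norm[OF that(2)] norm_triangle_ineq4[of x y] by linarith
  qed (use B R in auto)
  have up_u0: "up u0 \<in> K" using box0 by (simp add: K_def lo_up m0_def)
  obtain U U' where U0: "U 0 = up u0" and UK: "\<And>t. U t \<in> K"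
    and lip: "\<And>s t. norm (U t - U s) \<le> B * R * \<bar>t - s\<bar>"
    and lim: "\<And>t. 0 \<le> t \<Longrightarrow> (\<lambda>n. real (Suc n) *\<^sub>R (U (t + 1 / Suc n) - U t)) \<longlonglongrightarrow> U' t"
    and vi: "\<And>t v. 0 \<le> t \<Longrightarrow> v \<in> K \<Longrightarrow> (G (U t) - U' t) \<bullet> (v - U t) \<le> 0"
    using that by (rule projected_flow_exists[OF up_u0])
  show ?thesis
  proof (rule that[of "\<lambda>t. lo (U t)" "\<lambda>i. B * R / S i" "\<lambda>t. lo (U' t)"])
    show "lo (U 0) = u0" by (simp add: U0 lo_up)
    show "in_box (lo (U t))" "(\<Sum>i\<in>UNIV. lo (U t) i * b i) = (\<Sum>i\<in>UNIV. u0 i * b i)" for t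
      using UK[of t] by (auto simp: K_def m0_def)
    show "\<bar>lo (U t) i - lo (U s) i\<bar> \<le> B * R / S i * \<bar>t - s\<bar>" for s t i
    proof -
      have "\<bar>lo (U t) i - lo (U s) i\<bar> = \<bar>(U t - U s) $ i\<bar> / S i"
        using S(1)[of i] by (simp add: lo_def diff_divide_distrib[symmetric])
      also have "\<dots> \<le> B * R * \<bar>t - s\<bar> / S i"
        using S(1)[of i] order_trans[OF component_le_norm_cart lip]
        by (intro divide_right_mono) (auto simp: less_imp_le)
      finally show ?thesis by simp
    qed
    show "(\<lambda>n. real (Suc n) * (lo (U (t + 1 / Suc n)) i - lo (U t) i)) \<longlonglongrightarrow> lo (U' t) i"
      if "0 \<le> t" for t i
    proof -
      have "(\<lambda>n. (real (Suc n) *\<^sub>R (U (t + 1 / Suc n) - U t)) $ i / S i) \<longlonglongrightarrow> U' t $ i / S i"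
        using S(1)[of i] by (intro tendsto_divide tendsto_vec_nth lim[OF that]) auto
      then show ?thesis by (simp add: lo_def diff_divide_distrib[symmetric] del: of_nat_Suc)
    qed
    show "(\<Sum>i\<in>UNIV. a i * (F (lo (U t)) i - lo (U' t) i) * (v i - lo (U t) i)) \<le> 0"
      if t: "0 \<le> t" and "in_box v" "(\<Sum>i\<in>UNIV. v i * b i) = (\<Sum>i\<in>UNIV. u0 i * b i)" for t v
    proof -
      have "up v \<in> K" using that by (simp add: K_def lo_up m0_def)
      from vi[OF t this] have "(\<Sum>i\<in>UNIV. (S i * F (lo (U t)) i - U' t $ i) * (S i * v i - U t $ i)) \<le> 0"
        by (simp add: inner_vec_def G_def up_def)
      also have "(\<Sum>i\<in>UNIV. (S i * F (lo (U t)) i - U' t $ i) * (S i * v i - U t $ i))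
        = (\<Sum>i\<in>UNIV. a i * (F (lo (U t)) i - lo (U' t) i) * (v i - lo (U t) i))"
      proof (intro sum.cong refl)
        fix i
        have *: "x $ i = S i * lo x i" for x using S(1)[of i] by (simp add: lo_def)
        show "(S i * F (lo (U t)) i - U' t $ i) * (S i * v i - U t $ i)
          = a i * (F (lo (U t)) i - lo (U' t) i) * (v i - lo (U t) i)"
          unfolding *[of "U t"] *[of "U' t"] S(2)[symmetric] by (simp add: algebra_simps)
      qed
      finally show ?thesis .
    qed
  qed
qed

section \<open>Means and the Laplacian on the graph\<close>

lemma mass_eq_sum: "mass w r v = (\<Sum>i\<in>UNIV. v i * dpow w r i)"
  by (simp add: mass_def inner_V_def)

lemma dpow_nonneg: "0 \<le> dpow w r i"
  by (simp add: dpow_def)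

text \<open>The weight \<open>dpow w r i\<close> cancels the prefactor of the Laplacian, and
  symmetry of \<open>w\<close> makes the two remaining double sums equal.\<close>

lemma mass_graph_laplacian:
  assumes "weighted_graph w" "\<And>i. dpow w r i \<noteq> 0"
  shows "mass w r (graph_laplacian w r u) = 0"
proof -
  have "mass w r (graph_laplacian w r u) = (\<Sum>i\<in>UNIV. \<Sum>j\<in>UNIV. w i j * u i) - (\<Sum>i\<in>UNIV. \<Sum>j\<in>UNIV. w i j * u j)"
  proof -
    have "graph_laplacian w r u i * dpow w r i = (\<Sum>j\<in>UNIV. w i j * (u i - u j))" for i
      using assms(2)[of i] by (simp add: graph_laplacian_def)
    then show ?thesis by (simp add: mass_eq_sum right_diff_distrib sum_subtractf)
  qed
  also have "(\<Sum>i\<in>UNIV. \<Sum>j\<in>UNIV. w i j * u j) = (\<Sum>i\<in>UNIV. \<Sum>j\<in>UNIV. w i j * u i)"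
    using assms(1) by (subst sum.swap) (simp add: weighted_graph_def)
  finally show ?thesis by simp
qed

text \<open>The junk case: for a single vertex and \<open>r > 0\<close> the weight \<open>0 powr r\<close> vanishes, and then so
  does every mean (as \<open>0 / 0\<close>).\<close>

lemma single_vertex_if_dpow_eq_0:
  assumes "weighted_graph w" "dpow w r i = 0"
  shows "j = i"
proof -
  have "degree w i = 0" using assms(2) by (auto simp: dpow_def split: if_splits)
  then have w0: "w i k = 0" for k
  proof -
    have "0 \<le> w i j" for j using assms(1) by (simp add: weighted_graph_def)
    then show ?thesis
      using \<open>degree w i = 0\<close> by (simp add: degree_def sum_nonneg_eq_0_iff)
  qed
  \<comment> \<open>A nonempty path from \<open>i\<close> would begin with an edge at
    \<open>i\<close>, and there is none.\<close>
  have "(\<lambda>a b. w a b > 0)\<^sup>*\<^sup>* i j" using assms(1) by (simp add: weighted_graph_def)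
  then show ?thesis
    by (cases rule: converse_rtranclpE) (auto simp: w0)
qed

theorem theorem10:
  fixes w :: "'v::finite \<Rightarrow> 'v \<Rightarrow> real" and r \<epsilon> :: real and u0 :: "'v \<Rightarrow> real"
  assumes "weighted_graph w" and "0 \<le> r" and "r \<le> 1" and "\<epsilon> > 0"
    and "in_box u0"
  shows "\<exists>u \<beta>. (\<forall>t\<in>{0..}. in_box (u t)) \<and> H1_loc {0..} u \<and> C0_on {0..} u \<and> u 0 = u0 \<and>
           mc_AC_solution w r \<epsilon> {0..} u \<beta>"
proof -
  define m where "m = dpow w r"
  \<comment> \<open>The inner product must be positive definite, so a vanishing weight becomes 1 in
    it; the mass constraint keeps \<open>m\<close>.\<close>
  define a where "a i = (if m i = 0 then 1 else m i)" for i
  \<comment> \<open>The flow equation without its \<open>\<beta>\<close> terms, divided by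
    \<open>\<epsilon>\<close> and solved for the derivative.\<close>
  define F where "F x i = - graph_laplacian w r x i + (x i - mean_V w r x) / \<epsilon>" for x i
  have a: "0 < a i" for i
    using dpow_nonneg[of w r i] by (auto simp: a_def m_def)
  have L_add: "graph_laplacian w r (\<lambda>j. x j + y j) i = graph_laplacian w r x i + graph_laplacian w r y i"
    and M_add: "mean_V w r (\<lambda>j. x j + y j) = mean_V w r x + mean_V w r y" for x y i
    unfolding graph_laplacian_def mean_V_def mass_eq_sum add_divide_distrib[symmetric]
      distrib_left[symmetric] sum.distrib[symmetric]
    by (simp_all add: algebra_simps)
  have L_scale: "graph_laplacian w r (\<lambda>j. c * x j) i = c * graph_laplacian w r x i"
    and M_scale: "mean_V w r (\<lambda>j. c * x j) = c * mean_V w r x" for c x i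
    by (simp_all add: graph_laplacian_def mean_V_def mass_eq_sum sum_distrib_left algebra_simps)
  have F_add: "F (\<lambda>j. x j + y j) i = F x i + F y i" for x y i
    by (simp add: F_def L_add M_add add_divide_distrib diff_divide_distrib)
  have F_scale: "F (\<lambda>j. c * x j) i = c * F x i" for c x i
    by (simp add: F_def L_scale M_scale algebra_simps diff_divide_distrib)
  obtain u u' C where init: "u 0 = u0" and box: "\<And>t. in_box (u t)"
    and cons: "\<And>t. (\<Sum>i\<in>UNIV. u t i * m i) = (\<Sum>i\<in>UNIV. u0 i * m i)"
    and lip: "\<And>s t i. \<bar>u t i - u s i\<bar> \<le> C i * \<bar>t - s\<bar>"
    and lim: "\<And>t i. 0 \<le> t \<Longrightarrow> (\<lambda>n. real (Suc n) * (u (t + 1 / Suc n) i - u t i)) \<longlonglongrightarrow> u' t i"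
    and vi: "\<And>t v. 0 \<le> t \<Longrightarrow> in_box v \<Longrightarrow> (\<Sum>i\<in>UNIV. v i * m i) = (\<Sum>i\<in>UNIV. u0 i * m i)
      \<Longrightarrow> (\<Sum>i\<in>UNIV. a i * (F (u t) i - u' t i) * (v i - u t i)) \<le> 0"
    using that by (rule box_flow_exists[of a F u0 m, OF a F_add F_scale assms(5)])
  have H1: "H1_loc_deriv {0..} u u'"
    unfolding H1_loc_deriv_def
  proof (intro allI impI)
    fix i and p q :: real assume "p \<in> {0..}"
    then show "weak_deriv_on p q (\<lambda>t. u t i) (\<lambda>t. u' t i)"
      by (intro weak_deriv_on_difference_quotients[of _ "C i"] lip lim) auto
  qed
  have C0: "C0_on {0..} u"
    unfolding C0_on_def
  proof
    fix i
    have "0 \<le> C i" using lip[of 1 i 0] by simp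
    then show "continuous_on {0..} (\<lambda>t. u t i)"
      by (intro lipschitz_on_continuous_on[of "C i"] lipschitz_onI) (auto simp: dist_real_def lip)
  qed
  have ex: "\<exists>\<beta>. (\<forall>i. \<epsilon> * u' t i + \<epsilon> * graph_laplacian w r (u t) i - u t i + mean_V w r (u t)
      = \<beta> i - mean_V w r \<beta>) \<and> \<beta> \<in> Bset (u t)" if t: "0 \<le> t" for t
  proof -
    \<comment> \<open>\<open>q\<close> is the left side of the flow equation. As it equals
      \<open>\<epsilon> * (u' t i - F (u t) i)\<close>, the variational inequality of the flow
      becomes the exchange condition for \<open>q\<close>.\<close>
    define q where "q i = \<epsilon> * u' t i + \<epsilon> * graph_laplacian w r (u t) i - u t i + mean_V w r (u t)" for i
    have q: "q i = \<epsilon> * (u' t i - F (u t) i)" for i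
      using assms(4) by (simp add: q_def F_def field_simps)
    have vi': "0 \<le> (\<Sum>i\<in>UNIV. a i * q i * (v i - u t i))"
      if v: "in_box v" "(\<Sum>i\<in>UNIV. v i * m i) = (\<Sum>i\<in>UNIV. u t i * m i)" for v
    proof -
      have "(\<Sum>i\<in>UNIV. a i * q i * (v i - u t i))
          = - \<epsilon> * (\<Sum>i\<in>UNIV. a i * (F (u t) i - u' t i) * (v i - u t i))"
        unfolding sum_distrib_left by (intro sum.cong) (auto simp: q algebra_simps)
      then show ?thesis
        using vi[OF t v(1)] v(2) cons[of t] assms(4) by (simp add: mult_nonneg_nonpos)
    qed
    show ?thesis
    proof (cases "\<exists>i. m i = 0")
      case False
      then have am: "a = m" and m_pos: "\<And>i. 0 < m i"
        using a by (auto simp: a_def fun_eq_iff)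
      \<comment> \<open>With \<open>\<beta>\<close> taken as \<open>q + c\<close>, subtracting the
        mean must return \<open>q\<close>. This amounts to \<open>q\<close> having mean 0, which is
        checked term by term.\<close>
      obtain c where c: "(\<lambda>i. q i + c) \<in> Bset (u t)"
        using Bset_exchange[of m "u t" q] m_pos box vi' unfolding am by blast
      have mass1: "mass w r (\<lambda>_. 1) > 0"
        using m_pos by (auto simp: mass_eq_sum m_def intro!: sum_pos)
      have mean_const: "mean_V w r (\<lambda>_. k) = k" for k
        using M_scale[of k "\<lambda>_. 1"] mass1 by (simp add: mean_V_def)
      have "mean_V w r (u' t) = 0"
      proof -
        \<comment> \<open>Mass is constant along the flow, so every difference quotient has mass 0,
          and so has the limit.\<close>
        have "(\<lambda>n. \<Sum>i\<in>UNIV. real (Suc n) * (u (t + 1 / Suc n) i - u t i) * m i)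
            \<longlonglongrightarrow> (\<Sum>i\<in>UNIV. u' t i * m i)"
          by (intro tendsto_sum tendsto_mult lim[OF t] tendsto_const)
        moreover have "(\<Sum>i\<in>UNIV. real (Suc n) * (u (t + 1 / Suc n) i - u t i) * m i) = 0" for n
        proof -
          have "(\<Sum>i\<in>UNIV. real (Suc n) * (u (t + 1 / Suc n) i - u t i) * m i)
            = real (Suc n) * ((\<Sum>i\<in>UNIV. u (t + 1 / Suc n) i * m i) - (\<Sum>i\<in>UNIV. u t i * m i))"
            unfolding sum_subtractf[symmetric] sum_distrib_left
            by (intro sum.cong) (auto simp: algebra_simps)
          then show ?thesis by (simp only: cons) simp
        qed
        ultimately have "(\<Sum>i\<in>UNIV. u' t i * m i) = 0"
          by (simp add: LIMSEQ_const_iff)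
        then show ?thesis by (simp add: mean_V_def mass_eq_sum m_def)
      qed
      moreover have "mean_V w r (graph_laplacian w r (u t)) = 0"
        using mass_graph_laplacian[OF assms(1)] False by (simp add: mean_V_def m_def)
      moreover have "q = (\<lambda>i. \<epsilon> * u' t i + (\<epsilon> * graph_laplacian w r (u t) i
          + (-1 * u t i + mean_V w r (u t))))"
        by (auto simp: q_def)
      ultimately have "mean_V w r q = 0"
        by (simp only: M_add M_scale mean_const)
      then have "mean_V w r (\<lambda>i. q i + c) = c" by (simp only: M_add mean_const)
      with c show ?thesis
        by (intro exI[of _ "\<lambda>i. q i + c"]) (auto simp: q_def)
    next
      case True
      then obtain i where i: "m i = 0" by blast
      then have single: "j = i" for j
        using single_vertex_if_dpow_eq_0[OF assms(1)] by (simp add: m_def)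
      then have U: "UNIV = {i}" by auto
      have mean0: "mean_V w r v = 0" for v
        using i by (simp add: mean_V_def mass_eq_sum m_def U)
      \<comment> \<open>The mass constraint reads \<open>0 = 0\<close> here, so any value in the
        unit interval may be tested; 1 and 0 give the sign conditions. As all means are 0,
        \<open>q\<close> itself serves as \<open>\<beta>\<close>.\<close>
      have vi1: "0 \<le> q i * (x - u t i)" if "0 \<le> x" "x \<le> 1" for x
        using vi'[of "\<lambda>_. x"] that i by (simp add: in_box_def U a_def)
      have "q \<in> Bset (u t)"
      proof -
        have ui: "0 \<le> u t i" "u t i \<le> 1" using box by (auto simp: in_box_def)
        have "0 \<le> q i" if "u t i < 1" using vi1[of 1] that by (simp add: zero_le_mult_iff)
        moreover have "q i \<le> 0" if "0 < u t i" using vi1[of 0] that by (simp add: mult_le_0_iff)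
        ultimately have "\<forall>j. (u t j = 0 \<longrightarrow> 0 \<le> q j) \<and> (0 < u t j \<and> u t j < 1 \<longrightarrow> q j = 0)
            \<and> (u t j = 1 \<longrightarrow> q j \<le> 0)"
          using single by (metis antisym zero_less_one)
        then show ?thesis using box by (simp add: Bset_def)
      qed
      then show ?thesis by (intro exI[of _ q]) (simp add: mean0 q_def)
    qed
  qed
  \<comment> \<open>The equation holds at every nonnegative time, so \<open>\<beta>\<close> is
    chosen time by time.\<close>
  then have "\<forall>t\<in>{0..}. \<exists>\<beta>. (\<forall>i. \<epsilon> * u' t i + \<epsilon> * graph_laplacian w r (u t) i - u t i
      + mean_V w r (u t) = \<beta> i - mean_V w r \<beta>) \<and> \<beta> \<in> Bset (u t)"
    by simp
  from bchoice[OF this] obtain \<beta> where \<beta>: "\<forall>t\<in>{0..}. (\<forall>i. \<epsilon> * u' t i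
      + \<epsilon> * graph_laplacian w r (u t) i - u t i + mean_V w r (u t) = \<beta> t i - mean_V w r (\<beta> t))
      \<and> \<beta> t \<in> Bset (u t)" ..
  have "mc_AC_solution w r \<epsilon> {0..} u \<beta>"
    unfolding mc_AC_solution_def using C0 box H1 \<beta> by (auto intro!: exI[of _ u'] AE_I2)
  then show ?thesis
    using box C0 init H1 unfolding H1_loc_def by blast
qed

end
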